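(* Let $\mathcal H$ be a complex Hilbert space with open unit ball $B$. An inner automorphism of the group $\operatorname{Aut}(B)$ preserves $\perp_{Aut}$ in both directions if and only if it is conjugation by a pure rotation, i.e. it is of the form $\phi\mapsto\psi\circ\phi\circ\psi^{-1}$ with $\psi=\phi_{0,W}$ for some unitary operator $W$ on $\mathcal H$.
   Context: The inner product of $\mathcal H$ is linear in the first variable. For $a\in B$ and a unitary operator $U$ on $\mathcal H$, put $\alpha(a)=\sqrt{1-\|a\|^2}$, let $P_a$ be the orthogonal projection onto $\mathbb Ca$ and $Q_a=I-P_a$ (so $P_0=0$, $Q_0=I$). The group $\operatorname{Aut}(B)$ (under composition) of biholomorphic automorphisms of $B$ consists exactly of the maps $\phi_{a,U}(z)=U\frac{(P_a+\alpha(a)Q_a)z-a}{1-\langle z,a\rangle}$, $a\in B$, $U$ unitary; the pure rotations are the maps $\phi_{0,U}$. The bounded operator $M_{\phi_{a,U}}$ on the Hilbert space direct sum $\mathcal H\oplus\mathbb C$ is $$M_{\phi_{a,U}}(x,\lambda)=\bigl(U(P_a+\alpha(a)Q_a)x-\lambda Ua,\ -\langle x,a\rangle+\lambda\bigr).$$ For $S,T\in\mathcal B(\mathcal H\oplus\mathbb C)$ (operator norm), $S\perp_B T$ means $\|S+\lambda T\|\ge\|S\|$ for all $\lambda\in\mathbb C$. On $\operatorname{Aut}(B)$ define $\phi_{a,U}\perp_{Aut}\phi_{b,V}$ if and only if $M_{\phi_{a,U}}\perp_B M_{\phi_{b,V}}$. An inner automorphism of $\operatorname{Aut}(B)$ is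 a map $\Phi_\psi:\phi\mapsto\psi\circ\phi\circ\psi^{-1}$ with $\psi\in\operatorname{Aut}(B)$. A map $\Phi:\operatorname{Aut}(B)\to\operatorname{Aut}(B)$ preserves $\perp_{Aut}$ in both directions if for all $\phi,\eta\in\operatorname{Aut}(B)$: $\phi\perp_{Aut}\eta\iff\Phi(\phi)\perp_{Aut}\Phi(\eta)$. *)

theory Defs
  imports "HOL-Analysis.Analysis" "HOL-Algebra.Bij"
begin

section \<open>Complex Hilbert spaces\<close>

text \<open>A complex inner product space is taken as a real one (for the induced real inner
  product, the real part of the complex one) so that its norm, topology and completeness are
  those of the library. The norm is then the square root of \<open>cinner x x\<close>.\<close>

class complex_inner = real_inner +
  fixes scaleC :: "complex \<Rightarrow> 'a \<Rightarrow> 'a" (infixr "*\<^sub>C" 75)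
    and cinner :: "'a \<Rightarrow> 'a \<Rightarrow> complex"
  assumes scaleC_add_right: "c *\<^sub>C (x + y) = c *\<^sub>C x + c *\<^sub>C y"
    and scaleC_add_left: "(c + d) *\<^sub>C x = c *\<^sub>C x + d *\<^sub>C x"
    and scaleC_scaleC: "c *\<^sub>C (d *\<^sub>C x) = (c * d) *\<^sub>C x"
    and scaleR_scaleC: "r *\<^sub>R x = complex_of_real r *\<^sub>C x"
    and cinner_commute: "cinner x y = cnj (cinner y x)"
    and cinner_add_left: "cinner (x + y) z = cinner x z + cinner y z"
    and cinner_scaleC_left: "cinner (c *\<^sub>C x) y = c * cinner x y"
    and inner_eq_Re_cinner: "inner x y = Re (cinner x y)"

class chilbert_space = complex_inner + complete_space

instantiation complex :: chilbert_space
begin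

definition scaleC_complex_def: "scaleC = ((*) :: complex \<Rightarrow> complex \<Rightarrow> complex)"

definition cinner_complex_def: "cinner x y = x * cnj (y :: complex)"

instance
  by standard (auto simp: scaleC_complex_def cinner_complex_def inner_complex_def
      algebra_simps scaleR_conv_of_real)

end

text \<open>The Hilbert space direct sum; the real part of its inner product is the library's inner
  product on the product type.\<close>

instantiation prod :: (complex_inner, complex_inner) complex_inner
begin

definition scaleC_prod_def: "c *\<^sub>C z = (c *\<^sub>C fst z, c *\<^sub>C snd z)"

definition cinner_prod_def: "cinner z w = cinner (fst z) (fst w) + cinner (snd z) (snd w)"

instance
proof
  fix x y :: "'a \<times> 'b"
  show "cinner x y = cnj (cinner y x)"
    unfolding cinner_prod_def complex_cnj_add by (metis cinner_commute)
qed (auto simp: scaleC_prod_def cinner_prod_def inner_prod_def inner_eq_Re_cinner prod_eq_iff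
    scaleC_add_right scaleC_add_left scaleC_scaleC scaleR_scaleC cinner_add_left
    cinner_scaleC_left algebra_simps)

end

instance prod :: (chilbert_space, chilbert_space) chilbert_space ..

definition clinear :: "('a::complex_inner \<Rightarrow> 'b::complex_inner) \<Rightarrow> bool" where
  "clinear f \<longleftrightarrow> (\<forall>x y. f (x + y) = f x + f y) \<and> (\<forall>c x. f (c *\<^sub>C x) = c *\<^sub>C f x)"

definition unitary :: "('a::chilbert_space \<Rightarrow> 'a) \<Rightarrow> bool" where
  "unitary U \<longleftrightarrow> clinear U \<and> surj U \<and> (\<forall>x y. cinner (U x) (U y) = cinner x y)"

definition orth_proj :: "'a::chilbert_space set \<Rightarrow> 'a \<Rightarrow> 'a" where
  "orth_proj S x = (THE p. p \<in> S \<and> (\<forall>s\<in>S. cinner (x - p) s = 0))"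


section \<open>Birkhoff--James orthogonality of bounded operators\<close>

definition birkhoff_orth :: "('a::chilbert_space \<Rightarrow> 'a) \<Rightarrow> ('a \<Rightarrow> 'a) \<Rightarrow> bool" where
  "birkhoff_orth S T \<longleftrightarrow> (\<forall>c::complex. onorm (\<lambda>x. S x + c *\<^sub>C T x) \<ge> onorm S)"


section \<open>The automorphism group of the open unit ball\<close>

text \<open>Complex Frechet differentiability at each point of an open set.\<close>

definition hol_on :: "('a::chilbert_space \<Rightarrow> 'a) \<Rightarrow> 'a set \<Rightarrow> bool" where
  "hol_on f S \<longleftrightarrow> (\<forall>z\<in>S. \<exists>D. (f has_derivative D) (at z) \<and> clinear D)"

abbreviation unit_ball :: "'a::chilbert_space set" where
  "unit_ball \<equiv> ball 0 1"

text \<open>As in \<open>BijGroup\<close>, the elements are extensional functions, so that automorphisms of the ball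
  are equal iff they agree on the ball.\<close>

definition AutBall :: "('a::chilbert_space \<Rightarrow> 'a) monoid" where
  "AutBall = BijGroup unit_ball
     \<lparr>carrier := {f \<in> Bij unit_ball. hol_on f unit_ball \<and> hol_on (inv_into unit_ball f) unit_ball}\<rparr>"

definition inner_automorphism :: "('g, 'm) monoid_scheme \<Rightarrow> 'g \<Rightarrow> 'g \<Rightarrow> 'g" where
  "inner_automorphism G g = (\<lambda>h \<in> carrier G. g \<otimes>\<^bsub>G\<^esub> h \<otimes>\<^bsub>G\<^esub> inv\<^bsub>G\<^esub> g)"

definition proj_line :: "'a::chilbert_space \<Rightarrow> 'a \<Rightarrow> 'a" where
  "proj_line a = orth_proj (range (\<lambda>c. c *\<^sub>C a))"

definition coproj_line :: "'a::chilbert_space \<Rightarrow> 'a \<Rightarrow> 'a" where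
  "coproj_line a z = z - proj_line a z"

definition alpha :: "'a::chilbert_space \<Rightarrow> real" where
  "alpha a = sqrt (1 - (norm a)\<^sup>2)"

definition phi_aut :: "'a::chilbert_space \<Rightarrow> ('a \<Rightarrow> 'a) \<Rightarrow> 'a \<Rightarrow> 'a" where
  "phi_aut a U = (\<lambda>z \<in> unit_ball. U ((1 / (1 - cinner z a)) *\<^sub>C (proj_line a z + alpha a *\<^sub>R coproj_line a z - a)))"

definition M_op :: "'a::chilbert_space \<Rightarrow> ('a \<Rightarrow> 'a) \<Rightarrow> 'a \<times> complex \<Rightarrow> 'a \<times> complex" where
  "M_op a U = (\<lambda>(x, l). (U (proj_line a x + alpha a *\<^sub>R coproj_line a x) - l *\<^sub>C U a, - cinner x a + l))"

text \<open>The parameters of an automorphism are unique (see \<open>phi_aut_inject\<close> below), so this does not depend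
  on the choice of the representations.\<close>

definition orth_Aut :: "('a::chilbert_space \<Rightarrow> 'a) \<Rightarrow> ('a \<Rightarrow> 'a) \<Rightarrow> bool" where
  "orth_Aut f g \<longleftrightarrow> (\<exists>a U b V. a \<in> unit_ball \<and> unitary U \<and> b \<in> unit_ball \<and> unitary V \<and>
     f = phi_aut a U \<and> g = phi_aut b V \<and> birkhoff_orth (M_op a U) (M_op b V))"

definition preserves_orth_Aut :: "(('a::chilbert_space \<Rightarrow> 'a) \<Rightarrow> ('a \<Rightarrow> 'a)) \<Rightarrow> bool" where
  "preserves_orth_Aut \<Phi> \<longleftrightarrow>
     (\<forall>f \<in> carrier AutBall. \<forall>g \<in> carrier AutBall. orth_Aut f g \<longleftrightarrow> orth_Aut (\<Phi> f) (\<Phi> g))"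


section \<open>Well-definedness\<close>

lemma cinner_simps:
  "cinner x (y + z) = cinner x y + cinner x z"
  "cinner x (c *\<^sub>C y) = cnj c * cinner x y"
  "cinner (x - y) z = cinner x z - cinner y z"
  "cinner 0 z = 0" "cinner z 0 = 0"
  "cinner x x = 0 \<longleftrightarrow> x = 0"
proof -
  show "cinner x (y + z) = cinner x y + cinner x z"
    by (metis cinner_commute cinner_add_left complex_cnj_add)
  show "cinner x (c *\<^sub>C y) = cnj c * cinner x y"
    by (metis cinner_commute cinner_scaleC_left complex_cnj_mult)
  show "cinner (x - y) z = cinner x z - cinner y z"
    by (metis cinner_add_left add_diff_cancel diff_add_cancel)
  show 0: "cinner 0 z = 0" for z :: 'a
    using cinner_add_left[of 0 0 z] by simp
  show "cinner z 0 = 0"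
    by (metis 0 cinner_commute complex_cnj_zero)
  show "cinner x x = 0 \<longleftrightarrow> x = 0"
    using inner_eq_Re_cinner[of x x] 0 by force
qed

lemma scaleC_simps:
  fixes x :: "'a::complex_inner"
  shows "1 *\<^sub>C x = x" "0 *\<^sub>C x = 0" "c *\<^sub>C (0::'a) = 0"
proof -
  show "1 *\<^sub>C x = x" "0 *\<^sub>C x = 0"
    using scaleR_scaleC[of 1 x] scaleR_scaleC[of 0 x] by auto
  show "c *\<^sub>C (0::'a) = 0"
    using scaleC_add_right[of c 0 "0::'a"] by simp
qed

lemma proj_line_eq: "proj_line a x = (cinner x a / cinner a a) *\<^sub>C a"
  unfolding proj_line_def orth_proj_def
proof (rule the_equality)
  show "(cinner x a / cinner a a) *\<^sub>C a \<in> range (\<lambda>c. c *\<^sub>C a) \<and>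
    (\<forall>s\<in>range (\<lambda>c. c *\<^sub>C a). cinner (x - (cinner x a / cinner a a) *\<^sub>C a) s = 0)"
    by (cases "a = 0") (auto simp: cinner_simps cinner_scaleC_left scaleC_simps)
next
  fix p assume p: "p \<in> range (\<lambda>c. c *\<^sub>C a) \<and> (\<forall>s\<in>range (\<lambda>c. c *\<^sub>C a). cinner (x - p) s = 0)"
  then obtain c where c: "p = c *\<^sub>C a" by auto
  have "a \<in> range (\<lambda>c. c *\<^sub>C a)"
    by (metis rangeI scaleC_simps(1))
  then have "cinner (x - p) a = 0" using p by blast
  then show "p = (cinner x a / cinner a a) *\<^sub>C a"
    by (cases "a = 0") (auto simp: c cinner_simps cinner_scaleC_left scaleC_simps)
qed

lemma norm_scaleC: "norm (c *\<^sub>C x) = cmod c * norm x"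
proof -
  have "Im (cinner x x) = 0"
    using cinner_commute[of x x] by (metis cnj.simps(2) equal_neg_zero)
  then have "cinner x x = of_real ((norm x)\<^sup>2)"
    by (simp add: complex_eq_iff power2_norm_eq_inner inner_eq_Re_cinner)
  then have "cinner (c *\<^sub>C x) (c *\<^sub>C x) = of_real ((cmod c * norm x)\<^sup>2)"
    using complex_norm_square[of c]
    by (simp add: cinner_simps cinner_scaleC_left power_mult_distrib)
  then have "(norm (c *\<^sub>C x))\<^sup>2 = (cmod c * norm x)\<^sup>2"
    by (metis Re_complex_of_real inner_eq_Re_cinner power2_norm_eq_inner)
  then show ?thesis by simp
qed

lemma cmod_cinner_le: "cmod (cinner x y) \<le> norm x * norm y"
proof (cases "cinner x y = 0")
  case False
  define c where "c = cnj (cinner x y) / cmod (cinner x y)"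
  have c: "cmod c = 1" using False by (simp add: c_def norm_divide)
  have "cinner (c *\<^sub>C x) y = cmod (cinner x y)"
    using False by (simp add: cinner_scaleC_left c_def field_simps complex_norm_square[symmetric]
        power2_eq_square flip: of_real_mult)
  then have "cmod (cinner x y) = inner (c *\<^sub>C x) y"
    by (simp add: inner_eq_Re_cinner)
  also have "\<dots> \<le> norm (c *\<^sub>C x) * norm y" by (rule norm_cauchy_schwarz)
  finally show ?thesis by (simp add: norm_scaleC c)
qed auto

lemma unitary_imp_bounded_linear:
  assumes "unitary U"
  shows "bounded_linear U"
proof (rule bounded_linear_intro[where K = 1])
  show "norm (U x) \<le> norm x * 1" for x
    using assms by (simp add: unitary_def norm_eq_sqrt_inner inner_eq_Re_cinner)
qed (use assms in \<open>auto simp: unitary_def clinear_def scaleR_scaleC\<close>)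

lemma bounded_linear_proj_line: "bounded_linear (proj_line a)"
proof (rule bounded_linear_intro[where K = "norm a * norm a / cmod (cinner a a)"])
  show "norm (proj_line a x) \<le> norm x * (norm a * norm a / cmod (cinner a a))" for x
    using mult_right_mono[OF cmod_cinner_le[of x a], of "norm a / cmod (cinner a a)"]
    by (simp add: proj_line_eq norm_scaleC norm_divide mult_ac)
qed (simp_all add: proj_line_eq cinner_add_left add_divide_distrib scaleC_add_left
      scaleR_scaleC cinner_scaleC_left scaleC_scaleC)

lemma bounded_linear_M_op:
  assumes "unitary U"
  shows "bounded_linear (M_op a U)"
proof -
  note U = unitary_imp_bounded_linear[OF assms]
  have 1: "bounded_linear (\<lambda>x. cinner x a)"
    by (rule bounded_linear_intro[where K = "norm a"])
      (auto simp: cinner_add_left scaleR_scaleC cinner_scaleC_left scaleC_complex_def cmod_cinner_le)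
  have 2: "bounded_linear (\<lambda>l. l *\<^sub>C U a)"
    by (rule bounded_linear_intro[where K = "norm (U a)"])
      (auto simp: scaleC_add_left scaleR_scaleC scaleC_scaleC scaleC_complex_def norm_scaleC)
  have 3: "bounded_linear (\<lambda>x. U (proj_line a x + alpha a *\<^sub>R coproj_line a x))"
    unfolding coproj_line_def
    by (rule bounded_linear_compose[OF U] bounded_linear_add bounded_linear_proj_line
        bounded_linear_sub bounded_linear_ident
        bounded_linear_compose[OF bounded_linear_scaleR_right])+
  show ?thesis
    unfolding M_op_def case_prod_beta
    by (rule bounded_linear_Pair bounded_linear_sub bounded_linear_add bounded_linear_minus
        bounded_linear_snd bounded_linear_compose[OF 1 bounded_linear_fst]
        bounded_linear_compose[OF 2 bounded_linear_snd]
        bounded_linear_compose[OF 3 bounded_linear_fst])+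
qed

lemma phi_aut_inject:
  assumes a: "a \<in> unit_ball" and b: "b \<in> unit_ball" and U: "unitary U" and V: "unitary V"
    and eq: "phi_aut a U = phi_aut b V"
  shows "a = b \<and> U = V"
proof
  interpret U: bounded_linear U by (rule unitary_imp_bounded_linear[OF U])
  interpret V: bounded_linear V by (rule unitary_imp_bounded_linear[OF V])
  interpret P: bounded_linear "proj_line a" by (rule bounded_linear_proj_line)
  have al: "alpha a > 0"
    using a by (simp add: alpha_def power_less_one_iff)
  have V0: "x = 0" if "V x = 0" for x
  proof -
    have "cinner (V x) (V x) = cinner x x" using V by (simp add: unitary_def)
    then show ?thesis using that by (simp add: cinner_simps)
  qed
  have nz: "1 - cinner z c \<noteq> 0" if "z \<in> unit_ball" "c \<in> unit_ball" for z c :: 'a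
  proof -
    have "cmod (cinner z c) \<le> norm z * norm c" by (rule cmod_cinner_le)
    also have "\<dots> < 1"
      using that mult_strict_mono'[of "norm z" 1 "norm c" 1] by auto
    finally show ?thesis by auto
  qed
  have Paa: "proj_line c c = c" for c :: 'a
    by (cases "c = 0") (auto simp: proj_line_eq cinner_simps scaleC_simps)
  have PP: "proj_line a (proj_line a x) = proj_line a x" for x
    by (cases "a = 0") (auto simp: proj_line_eq cinner_simps cinner_scaleC_left scaleC_simps)
  have "phi_aut a U a = 0"
    unfolding phi_aut_def restrict_apply'[OF a] coproj_line_def Paa
    by (simp add: scaleC_simps U.zero)
  then have "phi_aut b V a = 0"
    by (simp only: eq)
  then have "(1 / (1 - cinner a b)) *\<^sub>C (proj_line b a + alpha b *\<^sub>R coproj_line b a - b) = 0"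
    unfolding phi_aut_def restrict_apply'[OF a] by (rule V0)
  then have "cmod (1 / (1 - cinner a b)) *
      norm (proj_line b a + alpha b *\<^sub>R coproj_line b a - b) = 0"
    by (simp flip: norm_scaleC)
  then have *: "proj_line b a + alpha b *\<^sub>R coproj_line b a - b = 0"
    using nz[OF a b] by simp
  have alb: "alpha b > 0"
    using b by (simp add: alpha_def power_less_one_iff)
  interpret Pb: bounded_linear "proj_line b" by (rule bounded_linear_proj_line)
  have "proj_line b (proj_line b a) = proj_line b a"
    by (cases "b = 0") (auto simp: proj_line_eq cinner_simps cinner_scaleC_left scaleC_simps)
  then have "proj_line b a = b"
    using arg_cong[OF *, of "proj_line b"]
    by (simp add: coproj_line_def Pb.add Pb.diff Pb.scaleR Paa)
  with * alb show ab: "a = b" by (simp add: coproj_line_def)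
  let ?A = "\<lambda>z. proj_line a z + alpha a *\<^sub>R coproj_line a z"
  have UV: "U (?A z - a) = V (?A z - a)"
    if z: "z \<in> unit_ball" for z
  proof -
    have hom: "U (c *\<^sub>C x) = c *\<^sub>C U x" "V (c *\<^sub>C x) = c *\<^sub>C V x" for c x
      using U V by (auto simp: unitary_def clinear_def)
    let ?d = "1 - cinner z a"
    have "(1 / ?d) *\<^sub>C U (?A z - a) = (1 / ?d) *\<^sub>C V (?A z - a)"
      using fun_cong[OF eq, of z] z by (simp add: phi_aut_def ab[symmetric] hom)
    then have "?d *\<^sub>C (1 / ?d) *\<^sub>C U (?A z - a)
        = ?d *\<^sub>C (1 / ?d) *\<^sub>C V (?A z - a)" by simp
    then show ?thesis using nz[OF z a] by (simp add: scaleC_scaleC scaleC_simps)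
  qed
  have UVa: "U a = V a"
    using UV[of 0] by (simp add: coproj_line_def P.zero U.neg V.neg)
  have UV1: "U (?A z) = V (?A z)" if "z \<in> unit_ball" for z
    using UV[OF that] by (simp add: U.diff V.diff UVa)
  show "U = V"
  proof
    fix y
    define z where "z = proj_line a y + (1 / alpha a) *\<^sub>R coproj_line a y"
    define t where "t = 1 / (1 + norm z)"
    have t: "t > 0" and tz: "t *\<^sub>R z \<in> unit_ball"
      by (simp_all add: t_def add_pos_nonneg divide_simps)
    have Pz: "proj_line a z = proj_line a y"
      by (simp add: z_def coproj_line_def P.add P.scaleR P.diff PP)
    have "alpha a *\<^sub>R coproj_line a z = coproj_line a y"
      unfolding coproj_line_def[of a z] Pz using al by (simp add: z_def)
    then have "proj_line a z + alpha a *\<^sub>R coproj_line a z = y"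
      by (simp add: Pz coproj_line_def)
    moreover have "proj_line a (t *\<^sub>R z) + alpha a *\<^sub>R coproj_line a (t *\<^sub>R z)
        = t *\<^sub>R (proj_line a z + alpha a *\<^sub>R coproj_line a z)"
      by (simp add: coproj_line_def P.scaleR scaleR_add_right scaleR_diff_right mult.commute)
    ultimately have "proj_line a (t *\<^sub>R z) + alpha a *\<^sub>R coproj_line a (t *\<^sub>R z) = t *\<^sub>R y"
      by simp
    then have "t *\<^sub>R U y = t *\<^sub>R V y"
      using UV1[OF tz] by (simp add: U.scaleR V.scaleR)
    then show "U y = V y" using t by simp
  qed
qed

end

theory Submission
  imports Defs "HOL-Complex_Analysis.Complex_Analysis"
begin

text \<open>Let \<open>M\<^sub>\<phi>\<close> denote the operator attached to an automorphism \<open>\<phi>\<close>. In homogeneous coordinates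
  \<open>M\<^sub>\<phi>\<close> induces \<open>\<phi>\<close>: it maps \<open>(z, 1)\<close> to a nonzero multiple of \<open>(\<phi> z, 1)\<close>. This determines an
  operator up to a scalar, so \<open>M\<^sub>\<phi> M\<^sub>\<psi>\<close> is a nonzero multiple of \<open>M\<close> of the composition
  (\<open>M_op_mult\<close>). Every automorphism is some \<open>phi_aut a U\<close> (\<open>AutBall_eq_phi_aut\<close>): after composition
  with a known automorphism it fixes \<open>0\<close>, and by the Schwarz lemma on complex lines an automorphism
  fixing \<open>0\<close> is unitary. It remains to decide which \<open>\<psi> = phi_aut c W\<close> induce a conjugation that
  preserves orthogonality.

  If \<open>c = 0\<close>, then \<open>M\<^sub>\<psi>\<close> is unitary and intertwines the operator of each automorphism with that of
  its conjugate (\<open>M_op_unitary_conj\<close>). All norms in the definition of Birkhoff--James orthogonality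
  are then unchanged.

  If \<open>c \<noteq> 0\<close>, conjugation by \<open>\<psi>\<close> fixes the identity but fails to preserve orthogonality to it. For a
  scalar rotation \<open>g z = u z\<close> with \<open>u \<noteq> -1\<close>, the numerical range of \<open>M\<^sub>g\<close> is contained in the segment
  from \<open>u\<close> to \<open>1\<close> and avoids \<open>0\<close>, and the identity is not orthogonal to \<open>g\<close>
  (\<open>scalar_rotation_not_birkhoff_orth_id\<close>). The operator of the conjugate of \<open>g\<close> is proportional to
  \<open>M\<^sub>\<psi> M\<^sub>g M\<^sub>\<psi>\<^sup>-\<^sup>1\<close>. As \<open>M\<^sub>\<psi>\<close> is not a multiple of an isometry, this similarity changes the
  shape of the numerical range, and for a suitable \<open>u \<noteq> -1\<close>, depending only on \<open>norm c\<close>, the new numerical range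
  contains \<open>0\<close> (\<open>not_preserves_orth_Aut_if_moves_0\<close>). A vector \<open>v\<close> with \<open>cinner (T v) v = 0\<close> makes the
  identity orthogonal to \<open>T\<close> (\<open>birkhoff_orth_id_if_cinner_eq_0\<close>).\<close>


section \<open>Complex inner product spaces\<close>

lemma scaleC_minus_left: "(- c) *\<^sub>C x = - (c *\<^sub>C x)" for x :: "'a::complex_inner"
  by (metis add.right_inverse add_eq_0_iff2 minus_minus scaleC_add_left scaleC_simps(2))

lemma scaleC_minus_right: "c *\<^sub>C (- x) = - (c *\<^sub>C x)" for x :: "'a::complex_inner"
  by (metis add.right_inverse add_eq_0_iff2 minus_minus scaleC_add_right scaleC_simps(3))

lemma scaleC_diff_left: "(c - d) *\<^sub>C x = c *\<^sub>C x - d *\<^sub>C x" for x :: "'a::complex_inner"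
  by (simp only: diff_conv_add_uminus scaleC_add_left scaleC_minus_left)

lemma scaleC_diff_right: "c *\<^sub>C (x - y) = c *\<^sub>C x - c *\<^sub>C y" for x :: "'a::complex_inner"
  by (simp only: diff_conv_add_uminus scaleC_add_right scaleC_minus_right)

lemma scaleC_eq_0_iff: "c *\<^sub>C x = 0 \<longleftrightarrow> c = 0 \<or> x = 0" for x :: "'a::complex_inner"
  by (metis norm_scaleC mult_eq_0_iff norm_eq_zero)

lemma cinner_minus_left: "cinner (- x) y = - cinner x y"
  using cinner_simps(3)[of 0 x y] by (simp add: cinner_simps)

lemma cinner_diff_right: "cinner x (y - z) = cinner x y - cinner x z"
  by (metis cinner_commute cinner_simps(3) complex_cnj_diff)

lemma cinner_minus_right: "cinner x (- y) = - cinner x y"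
  using cinner_diff_right[of x 0 y] by (simp add: cinner_simps)

lemmas scaleC_linear = scaleC_add_left scaleC_add_right scaleC_diff_left scaleC_diff_right
  scaleC_minus_left scaleC_minus_right scaleC_scaleC

lemmas cinner_sesquilinear = cinner_add_left cinner_simps cinner_scaleC_left cinner_minus_left
  cinner_minus_right cinner_diff_right

lemma cinner_self: "cinner x x = complex_of_real ((norm x)\<^sup>2)"
proof -
  have "Im (cinner x x) = 0"
    by (metis cinner_commute cnj.simps(2) equal_neg_zero)
  then show ?thesis
    by (simp add: complex_eq_iff power2_norm_eq_inner inner_eq_Re_cinner)
qed

lemma bounded_linear_cinner_left: "bounded_linear (\<lambda>x. cinner x y)"
  by (rule bounded_linear_intro[where K = "norm y"])
    (auto simp: cinner_add_left scaleR_scaleC cinner_scaleC_left scaleC_complex_def cmod_cinner_le)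

lemma bounded_bilinear_scaleC:
  "bounded_bilinear (\<lambda>c (x::'a::complex_inner). c *\<^sub>C x)"
proof
  show "(r *\<^sub>R c) *\<^sub>C x = r *\<^sub>R (c *\<^sub>C x)" "c *\<^sub>C (r *\<^sub>R x) = r *\<^sub>R (c *\<^sub>C x)"
    for r c and x :: 'a
    unfolding scaleR_scaleC by (simp_all add: scaleC_scaleC scaleC_complex_def mult.commute)
  show "\<exists>K. \<forall>c (x::'a). norm (c *\<^sub>C x) \<le> norm c * norm x * K"
    by (rule exI[of _ 1]) (simp add: norm_scaleC)
qed (simp_all add: scaleC_linear)

lemma clinear_add: "clinear f \<Longrightarrow> f (x + y) = f x + f y"
  and clinear_scaleC: "clinear f \<Longrightarrow> f (c *\<^sub>C x) = c *\<^sub>C f x"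
  by (simp_all add: clinear_def)

lemma clinear_scaleR: "clinear f \<Longrightarrow> f (r *\<^sub>R x) = r *\<^sub>R f x"
  by (simp add: scaleR_scaleC clinear_scaleC)

lemma clinear_zero: "clinear f \<Longrightarrow> f 0 = 0"
  using clinear_scaleC[of f 0 0] by (simp add: scaleC_simps)

lemma clinear_minus: "clinear f \<Longrightarrow> f (- x) = - f x"
  using clinear_scaleR[of f "-1" x] by simp

lemma clinear_diff: "clinear f \<Longrightarrow> f (x - y) = f x - f y"
  by (simp only: diff_conv_add_uminus clinear_add clinear_minus)

lemmas clinear_simps = clinear_add clinear_diff clinear_minus clinear_scaleC clinear_scaleR
  clinear_zero

lemma cinner_conv_inner:
  "cinner x y = Complex (inner x y) (- inner (\<i> *\<^sub>C x) y)"
  by (simp add: complex_eq_iff inner_eq_Re_cinner cinner_scaleC_left)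

text \<open>Polarization gives the real part; linearity over \<open>\<i>\<close> then gives the imaginary part.\<close>

lemma isometry_preserves_cinner:
  assumes "clinear f" and iso: "\<And>x. norm (f x) = norm x"
  shows "cinner (f x) (f y) = cinner x y"
proof -
  have "inner (f x) (f y) = inner x y" for x y
    using iso[of "x + y"] iso[of x] iso[of y]
    by (simp add: clinear_add[OF \<open>clinear f\<close>] norm_eq_sqrt_inner inner_add_left inner_add_right
        inner_commute)
  then show ?thesis
    by (simp add: cinner_conv_inner clinear_scaleC[OF \<open>clinear f\<close>, symmetric])
qed

lemma unitaryD:
  assumes "unitary U"
  shows unitary_clinear: "clinear U" and unitary_cinner: "cinner (U x) (U y) = cinner x y"
    and unitary_norm: "norm (U x) = norm x" and "U x = U y \<longleftrightarrow> x = y"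
    and unitary_bij: "bij U"
proof -
  show lin: "clinear U" and ci: "cinner (U x) (U y) = cinner x y" for x y
    using assms by (auto simp: unitary_def)
  show n: "norm (U x) = norm x" for x
    by (simp add: norm_eq_sqrt_inner inner_eq_Re_cinner ci)
  show "U x = U y \<longleftrightarrow> x = y" for x y
    using n[of "x - y"] by (auto simp: clinear_diff[OF lin])
  then show "bij U"
    using assms by (auto simp: bij_def inj_def unitary_def)
qed

lemma unitary_inv_apply:
  assumes "unitary U"
  shows "inv_into UNIV U (U x) = x" "U (inv_into UNIV U x) = x"
  using unitary_bij[OF assms] by (simp_all add: bij_is_inj bij_is_surj surj_f_inv_f)

lemma unitaryI:
  assumes "clinear U" "\<And>x. norm (U x) = norm x" "\<And>y. \<exists>x. U x = y"
  shows "unitary U"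
  unfolding unitary_def using assms isometry_preserves_cinner[of U] by (metis surjI)

lemma unitary_inv:
  assumes "unitary U"
  shows "unitary (inv_into UNIV U)"
proof (rule unitaryI)
  note i = unitary_inv_apply[OF assms] and lin = unitary_clinear[OF assms]
  show "clinear (inv_into UNIV U)"
    unfolding clinear_def
  proof safe
    show "inv_into UNIV U (x + y) = inv_into UNIV U x + inv_into UNIV U y" for x y
      by (metis i clinear_add[OF lin])
    show "inv_into UNIV U (c *\<^sub>C x) = c *\<^sub>C inv_into UNIV U x" for c x
      by (metis i clinear_scaleC[OF lin])
  qed
  show "norm (inv_into UNIV U x) = norm x" for x
    by (metis i(2) unitary_norm[OF assms])
  show "\<exists>x. inv_into UNIV U x = y" for y
    by (metis i(1))
qed

lemma unitary_comp:
  assumes U: "unitary U" and V: "unitary V"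
  shows "unitary (U \<circ> V)"
proof (rule unitaryI)
  show "clinear (U \<circ> V)"
    using unitary_clinear[OF U] unitary_clinear[OF V] by (simp add: clinear_def)
  show "norm ((U \<circ> V) x) = norm x" for x
    by (simp add: unitary_norm[OF U] unitary_norm[OF V])
  show "\<exists>x. (U \<circ> V) x = y" for y
    using unitary_inv_apply(2)[OF U] unitary_inv_apply(2)[OF V] by (metis comp_apply)
qed

lemma unitary_scaleC:
  assumes "cmod u = 1"
  shows "unitary ((*\<^sub>C) u :: 'a::chilbert_space \<Rightarrow> 'a)"
proof (rule unitaryI)
  have "u \<noteq> 0" using assms by auto
  then have "u *\<^sub>C ((1 / u) *\<^sub>C y) = y" for y :: 'a
    by (simp add: scaleC_scaleC scaleC_simps)
  then show "\<exists>x. u *\<^sub>C x = y" for y :: 'a by blast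
qed (use assms in \<open>simp_all add: clinear_def scaleC_linear norm_scaleC mult.commute\<close>)

lemma unitary_id: "unitary (id :: 'a::chilbert_space \<Rightarrow> 'a)"
  by (rule unitaryI) (simp_all add: clinear_def)


section \<open>The operators attached to the automorphisms\<close>

definition axial_scaling :: "'a::chilbert_space \<Rightarrow> 'a \<Rightarrow> 'a" where
  "axial_scaling a z = proj_line a z + alpha a *\<^sub>R coproj_line a z"

lemma alpha_pos: "a \<in> unit_ball \<Longrightarrow> alpha a > 0"
  by (simp add: alpha_def power_less_one_iff)

lemma alpha_square: "a \<in> unit_ball \<Longrightarrow> (alpha a)\<^sup>2 = 1 - (norm a)\<^sup>2"
  by (simp add: alpha_def power_le_one_iff)

text \<open>Since \<open>1 - alpha a\<close> equals \<open>(norm a)\<^sup>2 / (1 + alpha a)\<close>, the projections can be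
  eliminated without dividing by \<open>norm a\<close>; the case \<open>a = 0\<close> then needs no separate treatment.\<close>

lemma axial_scaling_eq:
  assumes a: "a \<in> unit_ball"
  shows "axial_scaling a z = alpha a *\<^sub>R z + (cinner z a / complex_of_real (1 + alpha a)) *\<^sub>C a"
proof (cases "a = 0")
  case False
  let ?c = "cinner z a"
  have al: "alpha a > 0" by (rule alpha_pos[OF a])
  have n: "cinner a a = complex_of_real ((1 - alpha a) * (1 + alpha a))"
    using alpha_square[OF a] by (simp add: cinner_self algebra_simps power2_eq_square
        flip: of_real_mult of_real_add of_real_diff)
  have nz: "cinner a a \<noteq> 0" using False by (simp add: cinner_simps)
  have "1 + complex_of_real (alpha a) \<noteq> 0"
    using al by (metis add_pos_pos less_irrefl of_real_1 of_real_add of_real_eq_0_iff zero_less_one)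
  moreover have "1 - complex_of_real (alpha a) \<noteq> 0"
    using nz n by auto
  ultimately have "(1 - complex_of_real (alpha a)) * (?c / cinner a a)
      = ?c / complex_of_real (1 + alpha a)"
    unfolding n by simp
  then have "?c / complex_of_real (1 + alpha a)
      = ?c / cinner a a - complex_of_real (alpha a) * (?c / cinner a a)"
    by (simp only: left_diff_distrib mult_1)
  then show ?thesis
    unfolding axial_scaling_def coproj_line_def proj_line_eq scaleR_scaleC scaleC_linear
    by (simp only: scaleC_linear) simp
qed (simp add: axial_scaling_def coproj_line_def proj_line_eq scaleC_simps cinner_simps alpha_def)

lemma clinear_axial_scaling: "clinear (axial_scaling a)"
  unfolding clinear_def
  by (simp add: axial_scaling_def coproj_line_def proj_line_eq scaleC_linear cinner_sesquilinear
      scaleR_scaleC add_divide_distrib mult_ac)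

lemma bounded_linear_axial_scaling: "bounded_linear (axial_scaling a)"
  unfolding axial_scaling_def coproj_line_def
  by (intro bounded_linear_add bounded_linear_sub bounded_linear_proj_line
      bounded_linear_const_scaleR bounded_linear_ident)

lemma cinner_axial_scaling: "cinner (axial_scaling a z) a = cinner z a"
  by (cases "a = 0")
    (auto simp: axial_scaling_def coproj_line_def proj_line_eq cinner_sesquilinear scaleR_scaleC)

lemma axial_scaling_self: "axial_scaling a a = a"
  by (cases "a = 0") (simp_all add: axial_scaling_def coproj_line_def proj_line_eq
      cinner_simps scaleC_simps)

lemma axial_scaling_square:
  assumes a: "a \<in> unit_ball"
  shows "axial_scaling a (axial_scaling a z) = complex_of_real ((alpha a)\<^sup>2) *\<^sub>C z + cinner z a *\<^sub>C a"
proof -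
  let ?al = "complex_of_real (alpha a)" and ?k = "cinner z a / complex_of_real (1 + alpha a)"
  have "1 + ?al \<noteq> 0"
    using alpha_pos[OF a]
    by (metis add_pos_pos less_irrefl of_real_1 of_real_add of_real_eq_0_iff zero_less_one)
  then have "?al * (cinner z a / (1 + ?al)) + cinner z a / (1 + ?al) = cinner z a"
    by (simp add: add_divide_distrib[symmetric] distrib_left[symmetric] divide_eq_eq
        algebra_simps)
  then have k: "?al * ?k + ?k = cinner z a" by simp
  have "axial_scaling a (axial_scaling a z) = ?al *\<^sub>C axial_scaling a z + ?k *\<^sub>C a"
    using axial_scaling_eq[OF a, of "axial_scaling a z"]
    by (simp only: cinner_axial_scaling scaleR_scaleC)
  also have "\<dots> = (?al * ?al) *\<^sub>C z + (?al * ?k + ?k) *\<^sub>C a"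
    unfolding axial_scaling_eq[OF a, of z] scaleR_scaleC scaleC_linear by (simp only: add.assoc)
  finally show ?thesis
    unfolding k by (simp add: power2_eq_square)
qed

lemma cinner_axial_scaling_both:
  assumes a: "a \<in> unit_ball"
  shows "cinner (axial_scaling a z) (axial_scaling a z)
    = complex_of_real ((alpha a)\<^sup>2 * (norm z)\<^sup>2 + (cmod (cinner z a))\<^sup>2)"
proof -
  have selfadj: "cinner (axial_scaling a x) y = cinner x (axial_scaling a y)" for x y
    using cinner_commute[of a y]
    by (simp add: axial_scaling_eq[OF a] cinner_sesquilinear scaleR_scaleC)
  have "cinner (axial_scaling a z) (axial_scaling a z)
      = cinner (axial_scaling a (axial_scaling a z)) z"
    by (simp add: selfadj)
  also have "\<dots> = complex_of_real ((alpha a)\<^sup>2 * (norm z)\<^sup>2) + cinner z a * cnj (cinner z a)"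
    by (simp add: axial_scaling_square[OF a] cinner_sesquilinear cinner_self
        cinner_commute[of a z])
  also have "cinner z a * cnj (cinner z a) = complex_of_real ((cmod (cinner z a))\<^sup>2)"
    by (simp only: complex_norm_square)
  finally show ?thesis by simp
qed

lemma M_op_apply:
  assumes "unitary U"
  shows "M_op a U (z, l) = (U (axial_scaling a z - l *\<^sub>C a), l - cinner z a)"
  by (simp add: M_op_def axial_scaling_def clinear_simps[OF unitary_clinear[OF assms]])

lemma M_op_0:
  assumes "unitary U"
  shows "M_op 0 U (z, l) = (U z, l)"
  by (simp add: M_op_apply[OF assms] axial_scaling_def coproj_line_def proj_line_eq alpha_def
      scaleC_simps cinner_simps)

lemma clinear_M_op:
  assumes "unitary U"
  shows "clinear (M_op a U)"
  unfolding clinear_def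
  by (auto simp: M_op_apply[OF assms] clinear_simps[OF unitary_clinear[OF assms]]
      clinear_simps[OF clinear_axial_scaling] scaleC_prod_def scaleC_complex_def
      cinner_sesquilinear scaleC_linear algebra_simps)

text \<open>A unitary intertwines the operators \<open>axial_scaling a\<close> and \<open>axial_scaling (U a)\<close>, since it
  maps the line of \<open>a\<close> to that of \<open>U a\<close>.\<close>

lemma unitary_axial_scaling:
  assumes "unitary U"
  shows "U (axial_scaling a z) = axial_scaling (U a) (U z)"
  by (simp add: axial_scaling_def coproj_line_def proj_line_eq alpha_def
      clinear_simps[OF unitary_clinear[OF assms]]
      unitary_cinner[OF assms] unitary_norm[OF assms])

lemma axial_scaling_minus: "axial_scaling (- a) = axial_scaling a"
  by (rule ext) (simp add: axial_scaling_def coproj_line_def proj_line_eq alpha_def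
      cinner_sesquilinear scaleC_linear)

text \<open>The inverse of \<open>phi_aut a U\<close> is \<open>phi_aut (- U a)\<close> with the inverse of \<open>U\<close>: it sends \<open>0\<close>
  to \<open>a\<close>, hence has its zero at the value \<open>- U a\<close> of \<open>phi_aut a U\<close> at \<open>0\<close>.\<close>

lemma M_op_left_inverse:
  assumes a: "a \<in> unit_ball" and U: "unitary U"
  shows "M_op (- U a) (inv_into UNIV U) (M_op a U p) = (alpha a)\<^sup>2 *\<^sub>R p"
proof (cases p)
  case (Pair z l)
  note lin = unitary_clinear[OF U] unitary_clinear[OF unitary_inv[OF U]] clinear_axial_scaling
  have *: "axial_scaling (- U a) (U w) = U (axial_scaling a w)" for w
    by (simp add: axial_scaling_minus unitary_axial_scaling[OF U])
  have aa: "cinner a a = 1 - complex_of_real ((alpha a)\<^sup>2)"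
    by (simp add: cinner_self alpha_square[OF a])
  show ?thesis
    unfolding Pair M_op_apply[OF U] M_op_apply[OF unitary_inv[OF U]]
    by (simp add: * clinear_simps[OF lin(1)] clinear_simps[OF lin(2)] clinear_simps[OF lin(3)]
        unitary_inv_apply[OF U] axial_scaling_square[OF a] axial_scaling_self
        cinner_sesquilinear unitary_cinner[OF U] cinner_axial_scaling scaleC_linear
        scaleR_scaleC scaleC_prod_def scaleC_complex_def aa algebra_simps)
qed

text \<open>The operators are similitudes of the indefinite form \<open>(norm z)\<^sup>2 - (cmod l)\<^sup>2\<close>, whose
  negative cone is the cone over the ball.\<close>

lemma M_op_indefinite_form:
  assumes a: "a \<in> unit_ball" and U: "unitary U"
  shows "(norm (fst (M_op a U (z, l))))\<^sup>2 - (cmod (snd (M_op a U (z, l))))\<^sup>2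
    = (alpha a)\<^sup>2 * ((norm z)\<^sup>2 - (cmod l)\<^sup>2)"
proof -
  let ?w = "axial_scaling a z - l *\<^sub>C a" and ?c = "cinner z a"
  have ac: "cinner a (axial_scaling a z) = cnj ?c"
    by (metis cinner_axial_scaling cinner_commute)
  have aa: "cinner a a = 1 - complex_of_real ((alpha a)\<^sup>2)"
    by (simp add: cinner_self alpha_square[OF a])
  have "complex_of_real ((norm ?w)\<^sup>2) - complex_of_real ((cmod (l - ?c))\<^sup>2)
      = cinner ?w ?w - (l - ?c) * cnj (l - ?c)"
    by (simp only: cinner_self complex_norm_square)
  also have "\<dots> = complex_of_real ((alpha a)\<^sup>2 * (norm z)\<^sup>2 + (cmod ?c)\<^sup>2)
      - ?c * cnj ?c - complex_of_real ((alpha a)\<^sup>2) * (l * cnj l)"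
    by (simp add: cinner_sesquilinear cinner_axial_scaling_both[OF a] cinner_axial_scaling ac aa
        algebra_simps)
  also have "\<dots> = complex_of_real ((alpha a)\<^sup>2 * ((norm z)\<^sup>2 - (cmod l)\<^sup>2))"
    by (simp add: algebra_simps flip: complex_norm_square)
  finally have "(norm ?w)\<^sup>2 - (cmod (l - ?c))\<^sup>2 = (alpha a)\<^sup>2 * ((norm z)\<^sup>2 - (cmod l)\<^sup>2)"
    by (metis of_real_diff of_real_eq_iff)
  then show ?thesis
    by (simp add: M_op_apply[OF U] unitary_norm[OF U])
qed


section \<open>Fractional linear maps of the ball\<close>

definition dehomogenize :: "'a::chilbert_space \<times> complex \<Rightarrow> 'a" where
  "dehomogenize p = (1 / snd p) *\<^sub>C fst p"

lemma dehomogenize_scaleC: "c \<noteq> 0 \<Longrightarrow> dehomogenize (c *\<^sub>C p) = dehomogenize p"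
  by (simp add: dehomogenize_def scaleC_prod_def scaleC_complex_def scaleC_scaleC)

lemma one_minus_cinner_nonzero:
  assumes "z \<in> unit_ball" "a \<in> unit_ball"
  shows "1 - cinner z a \<noteq> 0"
proof -
  have "cmod (cinner z a) \<le> norm z * norm a" by (rule cmod_cinner_le)
  also have "\<dots> < 1"
    using assms mult_strict_mono'[of "norm z" 1 "norm a" 1] by auto
  finally show ?thesis by auto
qed

lemma phi_aut_eq_dehomogenize:
  assumes U: "unitary U" and z: "z \<in> unit_ball"
  shows "phi_aut a U z = dehomogenize (M_op a U (z, 1))"
  using z unfolding phi_aut_def M_op_apply[OF U]
  by (simp add: dehomogenize_def axial_scaling_def clinear_simps[OF unitary_clinear[OF U]]
      scaleC_simps)

lemma M_op_eq_scaleC_phi_aut: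
  assumes a: "a \<in> unit_ball" and U: "unitary U" and z: "z \<in> unit_ball"
  shows "M_op a U (z, 1) = (1 - cinner z a) *\<^sub>C (phi_aut a U z, 1)"
  using one_minus_cinner_nonzero[OF z a]
  by (simp add: phi_aut_eq_dehomogenize[OF U z] dehomogenize_def M_op_apply[OF U]
      scaleC_prod_def scaleC_complex_def scaleC_scaleC scaleC_simps)

lemma phi_aut_in_ball:
  assumes a: "a \<in> unit_ball" and U: "unitary U" and z: "z \<in> unit_ball"
  shows "phi_aut a U z \<in> unit_ball"
proof -
  let ?M = "M_op a U (z, 1)"
  have "(norm z)\<^sup>2 < 1"
    using z by (simp add: power_less_one_iff)
  then have "(norm (fst ?M))\<^sup>2 - (cmod (snd ?M))\<^sup>2 < 0"
    unfolding M_op_indefinite_form[OF a U] using alpha_pos[OF a]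
    by (intro mult_pos_neg) simp_all
  then have "norm (fst ?M) < cmod (snd ?M)"
    by (simp add: power_less_imp_less_base)
  moreover have "snd ?M \<noteq> 0"
    using one_minus_cinner_nonzero[OF z a] by (simp add: M_op_apply[OF U])
  ultimately show ?thesis
    by (simp add: phi_aut_eq_dehomogenize[OF U z] dehomogenize_def norm_scaleC norm_divide)
qed

lemma phi_aut_left_inverse:
  assumes a: "a \<in> unit_ball" and U: "unitary U" and z: "z \<in> unit_ball"
  shows "phi_aut (- U a) (inv_into UNIV U) (phi_aut a U z) = z"
proof -
  note V = unitary_inv[OF U]
  let ?d = "1 - cinner z a" and ?M' = "M_op (- U a) (inv_into UNIV U)"
  have d: "?d \<noteq> 0" by (rule one_minus_cinner_nonzero[OF z a])
  have "(1 / ?d) *\<^sub>C M_op a U (z, 1) = (phi_aut a U z, 1)"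
    using d by (simp add: M_op_eq_scaleC_phi_aut[OF a U z] scaleC_scaleC scaleC_simps)
  then have "?M' (phi_aut a U z, 1) = (1 / ?d) *\<^sub>C ?M' (M_op a U (z, 1))"
    by (metis clinear_scaleC[OF clinear_M_op[OF V]])
  also have "\<dots> = ((1 / ?d) * complex_of_real ((alpha a)\<^sup>2)) *\<^sub>C (z, 1)"
    by (simp add: M_op_left_inverse[OF a U] scaleR_scaleC scaleC_scaleC)
  finally have "dehomogenize (?M' (phi_aut a U z, 1)) = dehomogenize (z, 1)"
    using d alpha_pos[OF a] by (simp add: dehomogenize_scaleC)
  then show ?thesis
    by (simp add: phi_aut_eq_dehomogenize[OF V phi_aut_in_ball[OF a U z]] dehomogenize_def
        scaleC_simps)
qed

lemma phi_aut_right_inverse: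
  assumes a: "a \<in> unit_ball" and U: "unitary U" and z: "z \<in> unit_ball"
  shows "phi_aut a U (phi_aut (- U a) (inv_into UNIV U) z) = z"
proof -
  have "- U a \<in> unit_ball" using a by (simp add: unitary_norm[OF U])
  from phi_aut_left_inverse[OF this unitary_inv[OF U] z] show ?thesis
    by (simp add: inv_inv_eq[OF unitary_bij[OF U]] clinear_minus[OF unitary_clinear]
        unitary_clinear[OF unitary_inv[OF U]] clinear_minus unitary_inv_apply[OF U])
qed

lemma hol_on_phi_aut:
  assumes a: "a \<in> unit_ball" and U: "unitary U"
  shows "hol_on (phi_aut a U) unit_ball"
  unfolding hol_on_def
proof
  fix z :: 'a assume z: "z \<in> unit_ball"
  note linU = unitary_clinear[OF U]
  let ?d = "\<lambda>z. 1 - cinner z a" and ?N = "\<lambda>z. U (axial_scaling a z - a)"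
  let ?D = "\<lambda>h. (1 / ?d z) *\<^sub>C U (axial_scaling a h) + (cinner h a / (?d z)\<^sup>2) *\<^sub>C ?N z"
  have d: "?d z \<noteq> 0" by (rule one_minus_cinner_nonzero[OF z a])
  have N: "(?N has_derivative (\<lambda>h. U (axial_scaling a h))) (at z)"
    by (rule bounded_linear.has_derivative[OF unitary_imp_bounded_linear[OF U]])
      (auto intro!: derivative_eq_intros
        bounded_linear.has_derivative[OF bounded_linear_axial_scaling])
  have "((\<lambda>z. 1 / ?d z) has_derivative (\<lambda>h. cinner h a / (?d z)\<^sup>2)) (at z)"
    using d by (auto intro!: derivative_eq_intros
        bounded_linear.has_derivative[OF bounded_linear_cinner_left]
        simp: power2_eq_square divide_inverse)
  from bounded_bilinear.FDERIV[OF bounded_bilinear_scaleC this N]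
  have "((\<lambda>z. (1 / ?d z) *\<^sub>C ?N z) has_derivative ?D) (at z)" .
  then have "(phi_aut a U has_derivative ?D) (at z)"
    by (rule has_derivative_transform_within_open[OF _ open_ball z])
      (simp add: phi_aut_def axial_scaling_def clinear_scaleC[OF linU])
  moreover have "clinear ?D"
    unfolding clinear_def
    by (simp add: clinear_simps[OF linU] clinear_simps[OF clinear_axial_scaling]
        scaleC_linear cinner_sesquilinear add_divide_distrib mult_ac)
  ultimately show "\<exists>D. (phi_aut a U has_derivative D) (at z) \<and> clinear D" by blast
qed


section \<open>The group of automorphisms\<close>

lemma hol_on_ball_cong:
  assumes "hol_on f unit_ball" "\<And>z. z \<in> unit_ball \<Longrightarrow> f z = g z"
  shows "hol_on g unit_ball"
  using assms has_derivative_transform_within_open[OF _ open_ball] unfolding hol_on_def by metis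

lemma hol_on_ball_compose:
  assumes f: "hol_on f unit_ball" and g: "hol_on g unit_ball" "g \<in> unit_ball \<rightarrow> unit_ball"
  shows "hol_on (compose unit_ball f g) unit_ball"
proof (rule hol_on_ball_cong)
  show "hol_on (\<lambda>z. f (g z)) unit_ball"
    unfolding hol_on_def
  proof
    fix z :: 'a assume z: "z \<in> unit_ball"
    obtain D where D: "(g has_derivative D) (at z)" "clinear D"
      using g z unfolding hol_on_def by metis
    obtain E where E: "(f has_derivative E) (at (g z))" "clinear E"
      using f g(2) z unfolding hol_on_def by blast
    have "((\<lambda>z. f (g z)) has_derivative (\<lambda>h. E (D h))) (at z)"
      using has_derivative_compose[OF D(1) E(1)] .
    moreover have "clinear (\<lambda>h. E (D h))"
      using D(2) E(2) by (simp add: clinear_def)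
    ultimately show "\<exists>D. ((\<lambda>z. f (g z)) has_derivative D) (at z) \<and> clinear D" by blast
  qed
qed (simp add: compose_eq)

lemma subgroup_AutBall:
  "subgroup {f \<in> Bij unit_ball. hol_on f unit_ball \<and> hol_on (inv_into unit_ball f) unit_ball}
     (BijGroup (unit_ball :: 'a::chilbert_space set))" (is "subgroup ?H ?G")
proof -
  interpret G: group ?G by (rule group_BijGroup)
  let ?B = "unit_ball :: 'a set"
  have inv_hol: "hol_on (m_inv ?G f) ?B \<longleftrightarrow> hol_on (inv_into ?B f) ?B" if "f \<in> Bij ?B" for f
    using that hol_on_ball_cong[of "inv_into ?B f" "m_inv ?G f"]
      hol_on_ball_cong[of "m_inv ?G f" "inv_into ?B f"] by (auto simp: inv_BijGroup)
  have H: "?H = {f \<in> carrier ?G. hol_on f ?B \<and> hol_on (m_inv ?G f) ?B}"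
    using inv_hol by (auto simp: BijGroup_def)
  have m: "f \<otimes>\<^bsub>?G\<^esub> g = compose ?B f g" if "f \<in> carrier ?G" "g \<in> carrier ?G" for f g
    using that by (simp add: BijGroup_def)
  have fs: "f \<in> ?B \<rightarrow> ?B" if "f \<in> carrier ?G" for f
    using that by (auto simp: BijGroup_def dest: Bij_imp_funcset)
  have "hol_on (\<one>\<^bsub>?G\<^esub>) ?B"
  proof (rule hol_on_ball_cong)
    show "hol_on (\<lambda>z. z) ?B"
      unfolding hol_on_def clinear_def by (auto intro!: exI[of _ "\<lambda>h. h"])
  qed (simp add: BijGroup_def)
  then have "\<one>\<^bsub>?G\<^esub> \<in> ?H" unfolding H by simp
  moreover have "f \<otimes>\<^bsub>?G\<^esub> g \<in> ?H" if f: "f \<in> ?H" and g: "g \<in> ?H" for f g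
  proof -
    have c: "f \<in> carrier ?G" "g \<in> carrier ?G" using f g unfolding H by auto
    have i: "m_inv ?G (f \<otimes>\<^bsub>?G\<^esub> g) = compose ?B (m_inv ?G g) (m_inv ?G f)"
      by (simp only: G.inv_mult_group[OF c] m[OF G.inv_closed[OF c(2)] G.inv_closed[OF c(1)]])
    show ?thesis
      unfolding H mem_Collect_eq i using f g c unfolding H
      by (auto simp: m[OF c] intro!: hol_on_ball_compose fs) (simp flip: m[OF c] add: c)
  qed
  moreover have "m_inv ?G f \<in> ?H" if "f \<in> ?H" for f
    using that unfolding H by simp
  moreover have "?H \<subseteq> carrier ?G" unfolding H by blast
  ultimately show ?thesis by (intro G.subgroupI) blast+
qed

interpretation AutBall: group "AutBall :: ('a::chilbert_space \<Rightarrow> 'a) monoid"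
  unfolding AutBall_def by (rule group.subgroup_imp_group[OF group_BijGroup subgroup_AutBall])

lemma AutBall_carrierD:
  assumes "f \<in> carrier AutBall"
  shows AutBall_Bij: "f \<in> Bij unit_ball" and AutBall_hol_on: "hol_on f unit_ball"
    and AutBall_extensional: "f \<in> extensional unit_ball"
    and AutBall_in_ball: "z \<in> unit_ball \<Longrightarrow> f z \<in> unit_ball"
proof -
  show Bij: "f \<in> Bij unit_ball" and "hol_on f unit_ball"
    using assms by (simp_all add: AutBall_def)
  show "f \<in> extensional unit_ball" "z \<in> unit_ball \<Longrightarrow> f z \<in> unit_ball"
    using Bij_imp_extensional[OF Bij] Bij_imp_funcset[OF Bij] by blast+
qed

lemma AutBall_mult_apply:
  assumes "f \<in> carrier AutBall" "g \<in> carrier AutBall" "z \<in> unit_ball"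
  shows "(f \<otimes>\<^bsub>AutBall\<^esub> g) z = f (g z)"
  using assms(3) AutBall_Bij[OF assms(1)] AutBall_Bij[OF assms(2)]
  by (simp add: AutBall_def BijGroup_def compose_eq)

lemma AutBall_one: "\<one>\<^bsub>AutBall\<^esub> = (\<lambda>z\<in>unit_ball. z)"
  by (simp add: AutBall_def BijGroup_def)

lemma AutBall_inv_apply:
  assumes f: "f \<in> carrier AutBall" and z: "z \<in> unit_ball"
  shows "(m_inv AutBall f) (f z) = z" "f ((m_inv AutBall f) z) = z"
  using AutBall_mult_apply[OF AutBall.inv_closed[OF f] f z]
    AutBall_mult_apply[OF f AutBall.inv_closed[OF f] z] f z
  by (simp_all add: AutBall_one)

lemma AutBall_eqI:
  assumes "f \<in> carrier AutBall" "g \<in> carrier AutBall" "\<And>z. z \<in> unit_ball \<Longrightarrow> f z = g z"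
  shows "f = g"
  using AutBall_extensional[OF assms(1)] AutBall_extensional[OF assms(2)] assms(3)
  by (rule extensionalityI)

lemma phi_aut_in_AutBall:
  assumes a: "a \<in> unit_ball" and U: "unitary U"
  shows "phi_aut a U \<in> carrier AutBall"
proof -
  let ?f = "phi_aut a U" and ?g = "phi_aut (- U a) (inv_into UNIV U)"
  have a': "- U a \<in> unit_ball" using a by (simp add: unitary_norm[OF U])
  note V = unitary_inv[OF U]
  have bij: "bij_betw ?f unit_ball unit_ball"
    by (rule bij_betw_byWitness[where f' = ?g])
      (use phi_aut_left_inverse[OF a U] phi_aut_right_inverse[OF a U] phi_aut_in_ball[OF a U]
        phi_aut_in_ball[OF a' V] in blast)+
  have "?g z = inv_into unit_ball ?f z" if "z \<in> unit_ball" for z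
    using inv_into_f_f[OF bij_betw_imp_inj_on[OF bij] phi_aut_in_ball[OF a' V that]]
    by (simp add: phi_aut_right_inverse[OF a U that])
  then have "hol_on (inv_into unit_ball ?f) unit_ball"
    by (rule hol_on_ball_cong[OF hol_on_phi_aut[OF a' V]])
  moreover have "?f \<in> extensional unit_ball"
    by (simp add: phi_aut_def)
  ultimately show ?thesis
    using bij hol_on_phi_aut[OF a U] by (simp add: AutBall_def Bij_def)
qed

lemma phi_aut_0:
  assumes U: "unitary U" and z: "z \<in> unit_ball"
  shows "phi_aut 0 U z = U z"
  by (simp add: phi_aut_eq_dehomogenize[OF U z] M_op_0[OF U] dehomogenize_def scaleC_simps)

lemma phi_aut_one: "phi_aut 0 id = \<one>\<^bsub>AutBall\<^esub>"
proof (rule AutBall_eqI)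
  show "phi_aut 0 id z = \<one>\<^bsub>AutBall\<^esub> z" if "z \<in> unit_ball" for z :: 'a
    using that by (simp add: phi_aut_0[OF unitary_id] AutBall_one)
qed (simp_all add: phi_aut_in_AutBall unitary_id)

lemma phi_aut_self:
  assumes U: "unitary U" and a: "a \<in> unit_ball"
  shows "phi_aut a U a = 0"
  by (simp add: phi_aut_eq_dehomogenize[OF U a] M_op_apply[OF U] dehomogenize_def
      axial_scaling_self scaleC_simps clinear_zero[OF unitary_clinear[OF U]])


section \<open>Cartan's classification of the automorphisms\<close>

text \<open>Restricting \<open>f\<close> to a complex line and pairing it with a vector gives a function of one
  complex variable, to which the classical Schwarz lemma applies.\<close>

lemma holomorphic_cinner_line:
  assumes f: "hol_on f unit_ball" and u: "norm u = 1"
  shows "(\<lambda>l. cinner (f (l *\<^sub>C u)) v) holomorphic_on ball 0 1"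
proof (rule holomorphic_onI)
  fix l :: complex assume "l \<in> ball 0 1"
  then have "l *\<^sub>C u \<in> unit_ball" using u by (simp add: norm_scaleC)
  then obtain D where D: "(f has_derivative D) (at (l *\<^sub>C u))" "clinear D"
    using f unfolding hol_on_def by blast
  have "((\<lambda>l. l *\<^sub>C u) has_derivative (\<lambda>h. h *\<^sub>C u)) (at l)"
    by (rule bounded_linear_imp_has_derivative)
      (rule bounded_bilinear.bounded_linear_left[OF bounded_bilinear_scaleC])
  from has_derivative_compose[OF this D(1)]
  have "((\<lambda>l. cinner (f (l *\<^sub>C u)) v) has_derivative (\<lambda>h. cinner (D (h *\<^sub>C u)) v)) (at l)"
    by (rule bounded_linear.has_derivative[OF bounded_linear_cinner_left])
  then have "((\<lambda>l. cinner (f (l *\<^sub>C u)) v) has_field_derivative cinner (D u) v) (at l)"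
    by (simp add: has_field_derivative_def clinear_scaleC[OF D(2)] cinner_scaleC_left
        mult_commute_abs)
  then show "(\<lambda>l. cinner (f (l *\<^sub>C u)) v) field_differentiable at l within ball 0 1"
    using field_differentiable_at_within field_differentiable_def by blast
qed

lemma Schwarz_on_line:
  assumes f: "hol_on f unit_ball" and fB: "\<And>z. z \<in> unit_ball \<Longrightarrow> f z \<in> unit_ball"
    and f0: "f 0 = 0" and u: "norm u = 1" and v: "norm v = 1"
  shows "cmod l < 1 \<Longrightarrow> cmod (cinner (f (l *\<^sub>C u)) v) \<le> cmod l"
    and "\<lbrakk>cmod m < 1; m \<noteq> 0; cmod (cinner (f (m *\<^sub>C u)) v) = cmod m\<rbrakk>
      \<Longrightarrow> \<exists>\<eta>. \<forall>l. cmod l < 1 \<longrightarrow> cinner (f (l *\<^sub>C u)) v = \<eta> * l"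
proof -
  let ?g = "\<lambda>l. cinner (f (l *\<^sub>C u)) v"
  have g0: "?g 0 = 0" by (simp add: scaleC_simps f0 cinner_simps)
  have g1: "cmod (?g l) < 1" if "cmod l < 1" for l
  proof -
    have "cmod (?g l) \<le> norm (f (l *\<^sub>C u))"
      using cmod_cinner_le[of "f (l *\<^sub>C u)" v] v by simp
    also have "\<dots> < 1"
      using fB[of "l *\<^sub>C u"] that u by (simp add: norm_scaleC)
    finally show ?thesis .
  qed
  note S = Schwarz_Lemma[OF holomorphic_cinner_line[OF f u] g0 g1]
  show "cmod l < 1 \<Longrightarrow> cmod (?g l) \<le> cmod l"
    using S(1)[of l] by simp
  show "\<exists>\<eta>. \<forall>l. cmod l < 1 \<longrightarrow> ?g l = \<eta> * l"
    if "cmod m < 1" "m \<noteq> 0" "cmod (?g m) = cmod m"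
    using S(3)[of m] that by blast
qed

text \<open>The direction \<open>v\<close> is taken along \<open>f z\<close>, so that the scalar Schwarz lemma bounds the full norm
  of \<open>f z\<close>.\<close>

lemma Schwarz_norm_le:
  assumes f: "hol_on f unit_ball" "\<And>z. z \<in> unit_ball \<Longrightarrow> f z \<in> unit_ball" "f 0 = 0"
    and z: "z \<in> unit_ball"
  shows "norm (f z) \<le> norm z"
proof (cases "z = 0 \<or> f z = 0")
  case False
  define u where "u = (1 / norm z) *\<^sub>R z"
  define v where "v = (1 / norm (f z)) *\<^sub>R f z"
  have u: "norm u = 1" and v: "norm v = 1" using False by (auto simp: u_def v_def)
  have zu: "complex_of_real (norm z) *\<^sub>C u = z"
    using False by (simp add: u_def flip: scaleR_scaleC)
  have "cinner (f z) v = complex_of_real (norm (f z))"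
    using False by (simp add: v_def scaleR_scaleC cinner_sesquilinear cinner_self power2_eq_square)
  then show ?thesis
    using Schwarz_on_line(1)[OF f u v, of "complex_of_real (norm z)"] z by (simp add: zu)
qed (use f(3) in auto)

text \<open>If \<open>f\<close> preserves the norm, the extremal case of the Schwarz lemma applies on every complex
  line through the origin, so \<open>f\<close> maps such lines linearly. The vector \<open>v = 2 *\<^sub>R f (u / 2)\<close> is
  chosen because it is the only candidate for the slope.\<close>

lemma norm_preserving_imp_homogeneous:
  assumes f: "hol_on f unit_ball" and iso: "\<And>z. z \<in> unit_ball \<Longrightarrow> norm (f z) = norm z"
    and u: "norm u = 1" and l: "cmod l < 1"
  shows "f (l *\<^sub>C u) = l *\<^sub>C (2 *\<^sub>R f ((1 / 2) *\<^sub>C u))"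
proof -
  define v where "v = 2 *\<^sub>R f ((1 / 2) *\<^sub>C u)"
  have f0: "f 0 = 0" using iso[of 0] by simp
  have fB: "f z \<in> unit_ball" if "z \<in> unit_ball" for z using iso[OF that] that by simp
  have v: "norm v = 1"
    using iso[of "(1 / 2) *\<^sub>C u"] u by (simp add: v_def norm_scaleC)
  have half: "cinner (f ((1 / 2) *\<^sub>C u)) v = 1 / 2"
  proof -
    have "f ((1 / 2) *\<^sub>C u) = (1 / 2) *\<^sub>R v" by (simp add: v_def)
    then show ?thesis by (simp only: scaleR_scaleC cinner_scaleC_left cinner_self v) simp
  qed
  obtain \<eta> where \<eta>: "\<forall>l. cmod l < 1 \<longrightarrow> cinner (f (l *\<^sub>C u)) v = \<eta> * l"
    using Schwarz_on_line(2)[OF f fB f0 u v, of "1 / 2"] half by (auto simp: norm_divide)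
  then have "\<eta> = 1" using half spec[OF \<eta>, of "1 / 2"] by (simp add: norm_divide)
  then have lv: "cinner (f (l *\<^sub>C u)) v = l" using \<eta> l by simp
  then have vl: "cinner v (f (l *\<^sub>C u)) = cnj l" by (metis cinner_commute)
  have "norm (f (l *\<^sub>C u)) = cmod l"
    using iso[of "l *\<^sub>C u"] u l by (simp add: norm_scaleC)
  then have "cinner (f (l *\<^sub>C u) - l *\<^sub>C v) (f (l *\<^sub>C u) - l *\<^sub>C v) = 0"
    by (simp add: cinner_sesquilinear cinner_self[of v] cinner_self[of "f (l *\<^sub>C u)"] v lv vl
        complex_norm_square del: of_real_power)
  then have "f (l *\<^sub>C u) - l *\<^sub>C v = 0" by (simp only: cinner_simps(6))
  then show ?thesis by (simp add: v_def)
qed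

text \<open>A map that is homogeneous on each line through the origin coincides with its derivative at the
  origin, which is complex linear.\<close>

lemma norm_preserving_imp_clinear:
  assumes f: "hol_on f unit_ball" and iso: "\<And>z. z \<in> unit_ball \<Longrightarrow> norm (f z) = norm z"
  shows "\<exists>D. clinear D \<and> (\<forall>z\<in>unit_ball. f z = D z)"
proof -
  have f0: "f 0 = 0" using iso[of 0] by simp
  obtain D where D: "(f has_derivative D) (at 0)" "clinear D"
    using f unfolding hol_on_def by (meson centre_in_ball zero_less_one)
  have "f z = D z" if z: "z \<in> unit_ball" for z
  proof -
    have hom: "f (t *\<^sub>R z) = t *\<^sub>R f z" if "\<bar>t\<bar> < 1" for t
    proof (cases "z = 0")
      case False
      define u where "u = (1 / norm z) *\<^sub>R z"
      have u: "norm u = 1" using False by (simp add: u_def)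
      have zu: "(s * norm z) *\<^sub>R u = s *\<^sub>R z" for s using False by (simp add: u_def)
      have "\<bar>t\<bar> * norm z < 1"
        using mult_strict_mono'[of "\<bar>t\<bar>" 1 "norm z" 1] that z by simp
      then have "f ((t * norm z) *\<^sub>R u) = (t * norm z) *\<^sub>R (2 *\<^sub>R f ((1 / 2) *\<^sub>C u))"
        unfolding scaleR_scaleC[of "t * norm z"]
        by (intro norm_preserving_imp_homogeneous[OF f iso u]) (simp_all add: norm_mult)
      moreover have "f ((1 * norm z) *\<^sub>R u) = (1 * norm z) *\<^sub>R (2 *\<^sub>R f ((1 / 2) *\<^sub>C u))"
        unfolding scaleR_scaleC[of "1 * norm z"]
        by (rule norm_preserving_imp_homogeneous[OF f iso u]) (use z in simp_all)
      ultimately show ?thesis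
        unfolding zu by simp
    qed (simp add: f0)
    have "((\<lambda>t. f (t *\<^sub>R z)) has_derivative (\<lambda>h. D (h *\<^sub>R z))) (at 0)"
    proof (rule has_derivative_compose[of "\<lambda>t. t *\<^sub>R z" "\<lambda>h. h *\<^sub>R z" 0 UNIV f D])
      show "((\<lambda>t. t *\<^sub>R z) has_derivative (\<lambda>h. h *\<^sub>R z)) (at 0)"
        by (auto intro!: derivative_eq_intros)
    qed (use D(1) in simp)
    then have "((\<lambda>t. f (t *\<^sub>R z)) has_vector_derivative D z) (at 0)"
      by (simp add: has_vector_derivative_def clinear_scaleR[OF D(2)])
    moreover have "((\<lambda>t. f (t *\<^sub>R z)) has_vector_derivative f z) (at 0)"
    proof (rule has_vector_derivative_transform_within_open[where S = "{-1<..<1}"])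
      show "((\<lambda>t. t *\<^sub>R f z) has_vector_derivative f z) (at 0)"
        by (auto intro!: derivative_eq_intros)
    qed (auto simp: hom)
    ultimately show ?thesis
      using vector_derivative_unique_at by blast
  qed
  then show ?thesis using D(2) by blast
qed

text \<open>The Schwarz inequality for both \<open>f\<close> and its inverse forces \<open>f\<close> to preserve the norm.\<close>

lemma AutBall_fixing_0_imp_unitary:
  assumes f: "f \<in> carrier AutBall" and f0: "f 0 = 0"
  shows "\<exists>U. unitary U \<and> (\<forall>z\<in>unit_ball. f z = U z)"
proof -
  let ?g = "m_inv AutBall f"
  have g: "?g \<in> carrier AutBall" using f by simp
  have g0: "?g 0 = 0"
    using AutBall_inv_apply(1)[OF f, of 0] by (simp add: f0)
  have iso: "norm (f z) = norm z" if z: "z \<in> unit_ball" for z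
  proof (rule antisym)
    show "norm (f z) \<le> norm z"
      by (rule Schwarz_norm_le[OF AutBall_hol_on[OF f] AutBall_in_ball[OF f] f0 z])
    show "norm z \<le> norm (f z)"
      using Schwarz_norm_le[OF AutBall_hol_on[OF g] AutBall_in_ball[OF g] g0 AutBall_in_ball[OF f z]]
      by (simp add: AutBall_inv_apply[OF f z])
  qed
  obtain U where U: "clinear U" "\<And>z. z \<in> unit_ball \<Longrightarrow> f z = U z"
    using norm_preserving_imp_clinear[OF AutBall_hol_on[OF f] iso] by blast
  have scale: "\<exists>t>0. t *\<^sub>R x \<in> unit_ball" for x :: 'a
    by (rule exI[of _ "1 / (1 + norm x)"]) (simp add: add_pos_nonneg divide_simps)
  have "unitary U"
  proof (rule unitaryI[OF U(1)])
    fix x :: 'a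
    obtain t where t: "t > 0" "t *\<^sub>R x \<in> unit_ball" using scale by blast
    then show "norm (U x) = norm x"
      using iso[OF t(2)] U(2)[OF t(2)] by (simp add: clinear_scaleR[OF U(1)])
    have "U (?g (t *\<^sub>R x)) = t *\<^sub>R x"
      using AutBall_inv_apply(2)[OF f t(2)] U(2)[OF AutBall_in_ball[OF g t(2)]] by simp
    then have "U ((1 / t) *\<^sub>R ?g (t *\<^sub>R x)) = x"
      using t(1) by (simp add: clinear_scaleR[OF U(1)])
    then show "\<exists>y. U y = x" by blast
  qed
  then show ?thesis using U(2) by blast
qed

text \<open>Both \<open>f\<close> and \<open>phi_aut a id\<close> vanish at the preimage \<open>a\<close> of \<open>0\<close> under \<open>f\<close>, so they differ by an
  automorphism fixing \<open>0\<close>.\<close>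

lemma AutBall_eq_phi_aut:
  assumes f: "f \<in> carrier AutBall"
  shows "\<exists>a U. a \<in> unit_ball \<and> unitary U \<and> f = phi_aut a U"
proof -
  define a where "a = (m_inv AutBall f) 0"
  define p where "p = phi_aut a id"
  have a: "a \<in> unit_ball" and fa: "f a = 0"
    using AutBall_in_ball[OF AutBall.inv_closed[OF f], of 0] AutBall_inv_apply(2)[OF f, of 0]
    by (simp_all add: a_def)
  have p: "p \<in> carrier AutBall" unfolding p_def by (rule phi_aut_in_AutBall[OF a unitary_id])
  let ?q = "f \<otimes>\<^bsub>AutBall\<^esub> m_inv AutBall p"
  have q: "?q \<in> carrier AutBall" using f p by simp
  have qp: "?q (p z) = f z" if z: "z \<in> unit_ball" for z
    using AutBall_mult_apply[OF f AutBall.inv_closed[OF p] AutBall_in_ball[OF p z]]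
    by (simp add: AutBall_inv_apply(1)[OF p z])
  have "?q 0 = 0"
    using qp[OF a] fa by (simp add: p_def phi_aut_self[OF unitary_id a])
  then obtain U where U: "unitary U" "\<forall>z\<in>unit_ball. ?q z = U z"
    using AutBall_fixing_0_imp_unitary[OF q] by blast
  have "f = phi_aut a U"
  proof (rule AutBall_eqI[OF f phi_aut_in_AutBall[OF a U(1)]])
    fix z :: 'a assume z: "z \<in> unit_ball"
    have "f z = U (p z)"
      using U(2) AutBall_in_ball[OF p z] qp[OF z] by metis
    then show "f z = phi_aut a U z"
      using z by (simp add: p_def phi_aut_def)
  qed
  then show ?thesis using a U(1) by blast
qed


section \<open>Composition and the attached operators\<close>

text \<open>Two injective linear maps that induce the same map on the points \<open>(z, 1)\<close> over the ball are
  proportional: on three collinear points the factors must agree, as the images of two distinct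
  points \<open>(z, 1)\<close> are linearly independent.\<close>

lemma proportional_on_ball_imp_proportional:
  fixes S T :: "'a::chilbert_space \<times> complex \<Rightarrow> 'a \<times> complex"
  assumes S: "clinear S" and T: "clinear T" and inj: "\<And>p. T p = 0 \<Longrightarrow> p = 0"
    and on_rays: "\<And>z. z \<in> unit_ball \<Longrightarrow> \<exists>k. S (z, 1) = k *\<^sub>C T (z, 1)"
  shows "\<exists>k. \<forall>p. S p = k *\<^sub>C T p"
proof -
  obtain k0 where k0: "S (0, 1) = k0 *\<^sub>C T (0, 1)"
    using on_rays[of 0] by auto
  have on_ball: "S (z, 1) = k0 *\<^sub>C T (z, 1)" if z: "z \<in> unit_ball" for z
  proof (cases "z = 0")
    case False
    have z2: "(1 / 2) *\<^sub>C z \<in> unit_ball" using z by (simp add: norm_scaleC)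
    obtain k where k: "S (z, 1) = k *\<^sub>C T (z, 1)" using on_rays[OF z] by blast
    obtain k' where k': "S ((1 / 2) *\<^sub>C z, 1) = k' *\<^sub>C T ((1 / 2) *\<^sub>C z, 1)"
      using on_rays[OF z2] by blast
    have mid: "2 *\<^sub>C ((1 / 2) *\<^sub>C z, 1) = (z, 1) + (0, 1::complex)"
      by (simp add: scaleC_prod_def scaleC_complex_def scaleC_scaleC scaleC_simps)
    have mid_image: "2 *\<^sub>C F ((1 / 2) *\<^sub>C z, 1) = F (z, 1) + F (0, 1)"
      if "clinear F" for F :: "'a \<times> complex \<Rightarrow> 'a \<times> complex"
      using arg_cong[OF mid, of F] by (simp only: clinear_scaleC[OF that] clinear_add[OF that])
    have "k' *\<^sub>C (T (z, 1) + T (0, 1)) = k *\<^sub>C T (z, 1) + k0 *\<^sub>C T (0, 1)"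
      using mid_image[OF S] unfolding k k0 k' mid_image[OF T, symmetric] scaleC_scaleC
      by (simp add: mult.commute)
    then have "T (k' *\<^sub>C ((z, 1) + (0, 1)) - k *\<^sub>C (z, 1) - k0 *\<^sub>C (0, 1)) = 0"
      by (simp only: clinear_diff[OF T] clinear_scaleC[OF T] clinear_add[OF T]) simp
    then have "k' *\<^sub>C ((z, 1) + (0, 1::complex)) - k *\<^sub>C (z, 1) - k0 *\<^sub>C (0, 1) = 0"
      using inj by blast
    then have "(k' - k) *\<^sub>C z = 0" "k' * 2 = k + k0"
      by (auto simp: scaleC_prod_def scaleC_complex_def scaleC_simps scaleC_diff_left
          zero_prod_def diff_eq_eq add.commute)
    then have "k = k0" using False by (simp add: scaleC_eq_0_iff)
    then show ?thesis using k by simp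
  qed (use k0 in simp)
  have "S (x, l) = k0 *\<^sub>C T (x, l)" for x l
  proof -
    define t where "t = complex_of_real (1 / (1 + norm x))"
    have "1 + norm x \<noteq> 0" using norm_ge_zero[of x] by linarith
    then have t: "t \<noteq> 0" unfolding t_def of_real_eq_0_iff by simp
    have "t *\<^sub>C x \<in> unit_ball"
      unfolding t_def scaleR_scaleC[symmetric] by (simp add: add_pos_nonneg divide_simps)
    note on_ball[OF this]
    moreover have xl: "(x, l) = (1 / t) *\<^sub>C (t *\<^sub>C x, 1) + (l - 1 / t) *\<^sub>C (0, 1)"
      using t by (simp add: scaleC_prod_def scaleC_complex_def scaleC_scaleC scaleC_simps)
    ultimately show ?thesis
      unfolding xl clinear_add[OF S] clinear_add[OF T] clinear_scaleC[OF S] clinear_scaleC[OF T] k0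
      by (simp add: scaleC_add_right scaleC_scaleC mult.commute)
  qed
  then show ?thesis by auto
qed

lemma M_op_eq_0D:
  assumes a: "a \<in> unit_ball" and U: "unitary U" and p: "M_op a U p = 0"
  shows "p = 0"
  using M_op_left_inverse[OF a U, of p] p alpha_pos[OF a]
    clinear_zero[OF clinear_M_op[OF unitary_inv[OF U]]] by simp

lemma M_op_mult:
  assumes a: "a \<in> unit_ball" and U: "unitary U" and b: "b \<in> unit_ball" and V: "unitary V"
    and d: "d \<in> unit_ball" and X: "unitary X"
    and eq: "phi_aut a U \<otimes>\<^bsub>AutBall\<^esub> phi_aut b V = phi_aut d X"
  obtains k where "k \<noteq> 0" "\<And>p. M_op a U (M_op b V p) = k *\<^sub>C M_op d X p"
proof -
  note MU = clinear_M_op[OF U, of a] and MV = clinear_M_op[OF V, of b]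
  have "\<exists>k. M_op a U (M_op b V (z, 1)) = k *\<^sub>C M_op d X (z, 1)" if z: "z \<in> unit_ball" for z
  proof -
    let ?w = "phi_aut b V z" and ?n = "1 - cinner z d"
    have w: "?w \<in> unit_ball" by (rule phi_aut_in_ball[OF b V z])
    have "phi_aut d X z = phi_aut a U ?w"
      using AutBall_mult_apply[OF phi_aut_in_AutBall[OF a U] phi_aut_in_AutBall[OF b V] z]
      by (simp add: eq)
    then have "M_op a U (M_op b V (z, 1))
        = ((1 - cinner z b) * (1 - cinner ?w a)) *\<^sub>C (phi_aut d X z, 1)"
      by (simp add: M_op_eq_scaleC_phi_aut[OF b V z] M_op_eq_scaleC_phi_aut[OF a U w]
          clinear_scaleC[OF MU] scaleC_scaleC)
    also have "\<dots> = ((1 - cinner z b) * (1 - cinner ?w a) / ?n) *\<^sub>C M_op d X (z, 1)"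
      using one_minus_cinner_nonzero[OF z d]
      by (simp add: M_op_eq_scaleC_phi_aut[OF d X z] scaleC_scaleC)
    finally show ?thesis by blast
  qed
  moreover have "clinear (\<lambda>p. M_op a U (M_op b V p))"
    unfolding clinear_def
    by (simp add: clinear_add[OF MU] clinear_add[OF MV] clinear_scaleC[OF MU] clinear_scaleC[OF MV])
  ultimately obtain k where k: "\<And>p. M_op a U (M_op b V p) = k *\<^sub>C M_op d X p"
    using proportional_on_ball_imp_proportional[of "\<lambda>p. M_op a U (M_op b V p)" "M_op d X"]
      clinear_M_op[OF X] M_op_eq_0D[OF d X] by blast
  moreover have "k \<noteq> 0"
  proof
    assume "k = 0"
    then have "M_op a U (M_op b V (0, 1)) = 0" using k by (simp add: scaleC_simps)
    then have "(0::'a, 1::complex) = 0"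
      by (metis M_op_eq_0D[OF a U] M_op_eq_0D[OF b V])
    then show False by (simp add: zero_prod_def)
  qed
  ultimately show thesis using that by blast
qed


section \<open>Orthogonality to the identity\<close>

lemma orth_Aut_phi_aut_iff:
  assumes "a \<in> unit_ball" "unitary U" "b \<in> unit_ball" "unitary V"
  shows "orth_Aut (phi_aut a U) (phi_aut b V) \<longleftrightarrow> birkhoff_orth (M_op a U) (M_op b V)"
proof
  assume "orth_Aut (phi_aut a U) (phi_aut b V)"
  then show "birkhoff_orth (M_op a U) (M_op b V)"
    unfolding orth_Aut_def using phi_aut_inject assms by metis
qed (use assms in \<open>auto simp: orth_Aut_def\<close>)

lemma M_op_id: "M_op 0 id = id"
  by (rule ext) (auto simp: M_op_0[OF unitary_id])

text \<open>This is the easy half of the Bhatia--Semrl criterion: \<open>v\<close> witnesses that \<open>0\<close> lies in the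
  numerical range of \<open>T\<close>.\<close>

lemma birkhoff_orth_id_if_cinner_eq_0:
  fixes T :: "'a::chilbert_space \<Rightarrow> 'a"
  assumes T: "bounded_linear T" and v: "v \<noteq> 0" and Tv: "cinner (T v) v = 0"
  shows "birkhoff_orth id T"
  unfolding birkhoff_orth_def
proof
  fix c :: complex
  let ?F = "\<lambda>x. id x + c *\<^sub>C T x"
  have "bounded_linear ?F"
    unfolding id_def
    by (intro bounded_linear_add bounded_linear_ident T bounded_linear_compose[OF _ T]
        bounded_bilinear.bounded_linear_right[OF bounded_bilinear_scaleC])
  then have F: "norm (?F v) \<le> onorm ?F * norm v" by (rule onorm)
  have "cinner (?F v) v = complex_of_real ((norm v)\<^sup>2)"
    by (simp add: cinner_sesquilinear cinner_self Tv)
  then have "(norm v)\<^sup>2 \<le> norm (?F v) * norm v"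
    using cmod_cinner_le[of "?F v" v] by (simp only: norm_of_real abs_power2)
  then have "norm v \<le> norm (?F v)" using v by (simp add: power2_eq_square)
  with F have "1 * norm v \<le> onorm ?F * norm v" by simp
  then have "1 \<le> onorm ?F" using v by (simp add: mult_le_cancel_right_pos del: mult_1)
  moreover have "onorm (id :: 'a \<Rightarrow> 'a) \<le> 1" by (rule onorm_bound) simp_all
  ultimately show "onorm (id :: 'a \<Rightarrow> 'a) \<le> onorm ?F" by linarith
qed

text \<open>The numerical range of the operator of the rotation \<open>z \<mapsto> u z\<close> is contained in the segment
  from \<open>u\<close> to \<open>1\<close>, which avoids \<open>0\<close>.\<close>

lemma scalar_rotation_not_birkhoff_orth_id:
  assumes u: "cmod u = 1" and u1: "u \<noteq> -1"
  shows "\<not> birkhoff_orth id (M_op 0 ((*\<^sub>C) u) :: 'a::chilbert_space \<times> complex \<Rightarrow> _)"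
proof
  let ?T = "M_op 0 ((*\<^sub>C) u) :: 'a \<times> complex \<Rightarrow> 'a \<times> complex"
  \<comment> \<open>minus the conjugate of the midpoint of the segment, so that \<open>1 + c\<close> and \<open>1 + c * u\<close> both have
    half the length of the segment as modulus\<close>
  define c where "c = - (1 + cnj u) / 2"
  define q where "q = cmod (1 - u) / 2"
  have uu: "cnj u * u = 1"
    using complex_norm_square[of u] u by (simp add: mult.commute)
  have "1 + c * u = (1 - u) / 2"
    using uu by (simp add: c_def field_simps)
  then have q1: "cmod (1 + c * u) = q" unfolding q_def by (simp only: norm_divide) simp
  have "1 + c = cnj ((1 - u) / 2)" by (simp add: c_def field_simps)
  then have q2: "cmod (1 + c) = q" unfolding q_def by (simp only: complex_mod_cnj norm_divide) simp
  have "q < 1"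
  proof -
    have sq: "(Re u)\<^sup>2 + (Im u)\<^sup>2 = 1" using u by (simp add: cmod_def)
    have "Re u \<noteq> -1"
      using sq u1 by (auto simp: complex_eq_iff)
    moreover have "- 1 \<le> Re u" using abs_Re_le_cmod[of u] u by linarith
    moreover have "(cmod (1 - u))\<^sup>2 = 2 - 2 * Re u"
      unfolding cmod_power2 using sq by (simp add: power2_eq_square algebra_simps)
    ultimately have "(cmod (1 - u))\<^sup>2 < 2\<^sup>2" by simp
    then have "cmod (1 - u) < 2" by (rule power_less_imp_less_base) simp
    then show ?thesis by (simp add: q_def)
  qed
  have "norm (id p + c *\<^sub>C ?T p) \<le> q * norm p" for p
  proof (cases p)
    case (Pair z l)
    have "id p + c *\<^sub>C ?T p = ((1 + c * u) *\<^sub>C z, (1 + c) * l)"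
      by (simp add: Pair M_op_0[OF unitary_scaleC[OF u]] scaleC_prod_def scaleC_complex_def
          scaleC_add_left scaleC_scaleC scaleC_simps algebra_simps)
    have "norm (id p + c *\<^sub>C ?T p) = sqrt (q\<^sup>2 * ((norm z)\<^sup>2 + (cmod l)\<^sup>2))"
      unfolding \<open>id p + c *\<^sub>C ?T p = _\<close> norm_Pair norm_scaleC norm_mult q1 q2
      by (simp only: power_mult_distrib distrib_left)
    then show ?thesis
      by (simp add: Pair norm_Pair real_sqrt_mult q_def)
  qed
  then have "onorm (\<lambda>p. id p + c *\<^sub>C ?T p) \<le> q"
    by (intro onorm_bound) (simp_all add: q_def)
  moreover have "1 \<le> onorm (id :: 'a \<times> complex \<Rightarrow> _)"
    using onorm[of "id :: 'a \<times> complex \<Rightarrow> _" "(0, 1)"] by (simp add: id_def norm_Pair)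
  moreover assume "birkhoff_orth id ?T"
  then have "onorm (id :: 'a \<times> complex \<Rightarrow> _) \<le> onorm (\<lambda>p. id p + c *\<^sub>C ?T p)"
    by (simp add: birkhoff_orth_def)
  ultimately show False using \<open>q < 1\<close> by linarith
qed

text \<open>Up to \<open>W\<close>, which drops out of inner products, \<open>M\<close> leaves the plane spanned by \<open>c\<close> and the
  second summand invariant. On this plane the search for a zero of \<open>cinner (M T w) (M w)\<close>, where \<open>T\<close> is the
  operator of a scalar rotation, is a computation with complex numbers.\<close>

lemma cinner_M_op_on_axis:
  assumes c: "c \<in> unit_ball" and W: "unitary W" and u: "cmod u = 1" and r: "norm c = r"
  defines "M \<equiv> M_op c W"
  shows "cinner (M (M_op 0 ((*\<^sub>C) u) (t *\<^sub>C c, 1))) (M (t *\<^sub>C c, 1))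
    = (u * t - 1) * cnj (t - 1) * r\<^sup>2 + (1 - u * t * r\<^sup>2) * cnj (1 - t * r\<^sup>2)"
proof -
  have M: "M (s *\<^sub>C c, 1) = (W ((s - 1) *\<^sub>C c), 1 - s * r\<^sup>2)" for s
    by (simp add: M_def M_op_apply[OF W] clinear_scaleC[OF clinear_axial_scaling]
        axial_scaling_self cinner_scaleC_left cinner_self r scaleC_diff_left scaleC_simps)
  have "M_op 0 ((*\<^sub>C) u) (t *\<^sub>C c, 1) = ((u * t) *\<^sub>C c, 1)"
    by (simp add: M_op_0[OF unitary_scaleC[OF u]] scaleC_scaleC)
  then show ?thesis
    by (simp add: M cinner_prod_def unitary_cinner[OF W] cinner_sesquilinear cinner_self r
        cinner_complex_def)
qed


section \<open>Conjugation by a rotation\<close>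

lemma onorm_unitary_conj:
  assumes "unitary J" and F: "\<And>x. F' (J x) = J (F x)"
  shows "onorm F' = onorm F"
proof -
  have "range (\<lambda>x. norm (F' x) / norm x) = (\<lambda>x. norm (F' x) / norm x) ` range J"
    by (simp only: bij_is_surj[OF unitary_bij[OF assms(1)]])
  also have "\<dots> = range (\<lambda>x. norm (F' (J x)) / norm (J x))" by (rule image_image)
  also have "(\<lambda>x. norm (F' (J x)) / norm (J x)) = (\<lambda>x. norm (F x) / norm x)"
    by (simp add: F unitary_norm[OF assms(1)])
  finally show ?thesis by (simp add: onorm_def)
qed

lemma birkhoff_orth_unitary_conj:
  assumes J: "unitary J" and S: "\<And>x. S' (J x) = J (S x)" and T: "\<And>x. T' (J x) = J (T x)"
  shows "birkhoff_orth S' T' \<longleftrightarrow> birkhoff_orth S T"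
proof -
  have "onorm (\<lambda>x. S' x + c *\<^sub>C T' x) = onorm (\<lambda>x. S x + c *\<^sub>C T x)" for c
    by (rule onorm_unitary_conj[OF J])
      (simp add: S T clinear_add[OF unitary_clinear[OF J]] clinear_scaleC[OF unitary_clinear[OF J]])
  moreover have "onorm S' = onorm S" using J S by (rule onorm_unitary_conj)
  ultimately show ?thesis by (simp add: birkhoff_orth_def)
qed

abbreviation unitary_conj :: "('a \<Rightarrow> 'a) \<Rightarrow> ('a \<Rightarrow> 'a) \<Rightarrow> 'a \<Rightarrow> 'a" where
  "unitary_conj W U \<equiv> W \<circ> U \<circ> inv_into UNIV W"

lemma unitary_unitary_conj: "unitary W \<Longrightarrow> unitary U \<Longrightarrow> unitary (unitary_conj W U)"
  by (simp add: unitary_comp unitary_inv)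

lemma unitary_M_op_0:
  assumes W: "unitary W"
  shows "unitary (M_op 0 W)"
proof (rule unitaryI)
  show "clinear (M_op 0 W)" by (rule clinear_M_op[OF W])
  show "norm (M_op 0 W p) = norm p" for p
    by (cases p) (simp add: M_op_0[OF W] norm_Pair unitary_norm[OF W])
  show "\<exists>p. M_op 0 W p = q" for q
    by (cases q) (metis M_op_0[OF W] unitary_inv_apply(2)[OF W])
qed

text \<open>For \<open>a = 0\<close> the operator \<open>M_op 0 W\<close> is block diagonal and unitary, and the proportionality of
  \<open>M_op_mult\<close> becomes an equality.\<close>

lemma M_op_unitary_conj:
  assumes W: "unitary W" and U: "unitary U"
  shows "M_op (W a) (unitary_conj W U) (M_op 0 W p) = M_op 0 W (M_op a U p)"
proof (cases p)
  case (Pair z l)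
  have "axial_scaling (W a) (W z) - l *\<^sub>C W a = W (axial_scaling a z - l *\<^sub>C a)"
    by (simp add: unitary_axial_scaling[OF W] clinear_simps[OF unitary_clinear[OF W]])
  then show ?thesis
    by (simp add: Pair M_op_0[OF W] M_op_apply[OF U] M_op_apply[OF unitary_unitary_conj[OF W U]]
        unitary_inv_apply[OF W] unitary_cinner[OF W])
qed

lemma inner_automorphism_rotation:
  assumes W: "unitary W" and a: "a \<in> unit_ball" and U: "unitary U"
  shows "inner_automorphism AutBall (phi_aut 0 W) (phi_aut a U)
    = phi_aut (W a) (unitary_conj W U)" (is "_ = ?h")
proof -
  let ?R = "phi_aut 0 W" and ?f = "phi_aut a U"
  have R: "?R \<in> carrier AutBall" and f: "?f \<in> carrier AutBall"
    using a by (simp_all only: phi_aut_in_AutBall W U mem_ball_0 norm_zero zero_less_one)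
  have Wa: "W a \<in> unit_ball" using a by (simp add: unitary_norm[OF W])
  note X = unitary_unitary_conj[OF W U]
  have h: "?h \<in> carrier AutBall" by (rule phi_aut_in_AutBall[OF Wa X])
  have "?R \<otimes>\<^bsub>AutBall\<^esub> ?f = ?h \<otimes>\<^bsub>AutBall\<^esub> ?R"
  proof (rule AutBall_eqI)
    fix z :: 'a assume z: "z \<in> unit_ball"
    have Wz: "W z \<in> unit_ball" using z by (simp add: unitary_norm[OF W])
    have "?h (W z) = dehomogenize (M_op 0 W (M_op a U (z, 1)))"
      using M_op_unitary_conj[OF W U, of a "(z, 1)"]
      by (simp add: phi_aut_eq_dehomogenize[OF X Wz] M_op_0[OF W])
    also have "\<dots> = W (?f z)"
      by (simp add: phi_aut_eq_dehomogenize[OF U z] M_op_apply[OF U] M_op_0[OF W]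
          dehomogenize_def clinear_scaleC[OF unitary_clinear[OF W]])
    finally show "(?R \<otimes>\<^bsub>AutBall\<^esub> ?f) z = (?h \<otimes>\<^bsub>AutBall\<^esub> ?R) z"
      by (simp add: AutBall_mult_apply[OF R f z] AutBall_mult_apply[OF h R z]
          phi_aut_0[OF W z] phi_aut_0[OF W phi_aut_in_ball[OF a U z]])
  qed (use R f h in auto)
  then show ?thesis
    using R f h by (simp add: inner_automorphism_def AutBall.m_assoc)
qed


section \<open>Inner automorphisms preserving orthogonality\<close>

lemma inner_automorphism_rotation_preserves_orth_Aut:
  assumes W: "unitary W"
  shows "preserves_orth_Aut (inner_automorphism AutBall (phi_aut 0 W))"
  unfolding preserves_orth_Aut_def
proof (intro ballI)
  fix f g :: "'a \<Rightarrow> 'a"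
  assume "f \<in> carrier AutBall" "g \<in> carrier AutBall"
  then obtain a U b V where f: "a \<in> unit_ball" "unitary U" "f = phi_aut a U"
    and g: "b \<in> unit_ball" "unitary V" "g = phi_aut b V"
    using AutBall_eq_phi_aut by metis
  have W_ball: "W z \<in> unit_ball \<longleftrightarrow> z \<in> unit_ball" for z
    by (simp add: unitary_norm[OF W])
  have orth: "birkhoff_orth (M_op (W a) (unitary_conj W U)) (M_op (W b) (unitary_conj W V))
      \<longleftrightarrow> birkhoff_orth (M_op a U) (M_op b V)"
    using unitary_M_op_0[OF W] M_op_unitary_conj[OF W f(2)] M_op_unitary_conj[OF W g(2)]
    by (rule birkhoff_orth_unitary_conj)
  show "orth_Aut f g \<longleftrightarrow> orth_Aut (inner_automorphism AutBall (phi_aut 0 W) f)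
      (inner_automorphism AutBall (phi_aut 0 W) g)"
    using f(1,2) g(1,2) orth
    by (simp only: f(3) g(3) inner_automorphism_rotation[OF W] orth_Aut_phi_aut_iff W_ball
        unitary_unitary_conj[OF W])
qed

text \<open>Let \<open>\<psi> = phi_aut c W\<close>. The conjugate \<open>h\<close> of a scalar rotation \<open>g\<close> satisfies \<open>h \<psi> = \<psi> g\<close>. Hence for
  \<open>v = M w\<close>, with \<open>M\<close> the operator of \<open>\<psi>\<close>, the operator of \<open>h\<close> maps \<open>v\<close> to a multiple of \<open>M T w\<close>,
  with \<open>T\<close> the operator of \<open>g\<close>. It suffices to make \<open>M T w\<close> orthogonal to \<open>M w\<close>.\<close>

lemma not_preserves_orth_Aut_if_moves_0:
  assumes c: "c \<in> unit_ball" and W: "unitary W" and c0: "c \<noteq> 0"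
  shows "\<not> preserves_orth_Aut (inner_automorphism AutBall (phi_aut c W))"
proof
  let ?\<psi> = "phi_aut c W" and ?B = "unit_ball :: 'a set"
  assume pres: "preserves_orth_Aut (inner_automorphism AutBall ?\<psi>)"
  define r where "r = norm c"
  have r: "r > 0" using c0 by (simp add: r_def)
  \<comment> \<open>By \<open>cinner_M_op_on_axis\<close> the inner product is affine in \<open>u\<close>. For imaginary \<open>t\<close> with
    \<open>cmod t = 1 / r\<close> its constant term \<open>s\<close> and its coefficient of \<open>u\<close> are conjugate, so that the
    root \<open>u\<close> has modulus \<open>1\<close>; it differs from \<open>-1\<close> because \<open>s\<close> is not real.\<close>
  define t where "t = \<i> / r"
  define s where "s = 1 + r\<^sup>2 + 2 * \<i> * r"
  define u where "u = - (s / cnj s)"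
  have s: "cnj s \<noteq> 0" "cnj s \<noteq> s"
    using r by (auto simp: s_def complex_eq_iff)
  have u: "cmod u = 1" using s(1) by (simp add: u_def norm_divide)
  have u1: "u \<noteq> -1" using s by (simp add: u_def divide_eq_eq)
  note R = unitary_scaleC[OF u, where 'a='a]
  let ?g = "phi_aut 0 ((*\<^sub>C) u) :: 'a \<Rightarrow> 'a"
  have zero: "(0::'a) \<in> ?B" by simp
  have \<psi>: "?\<psi> \<in> carrier AutBall" and g: "?g \<in> carrier AutBall"
    using c W R by (simp_all add: phi_aut_in_AutBall)
  let ?h = "inner_automorphism AutBall ?\<psi> ?g"
  have h_eq: "?h = ?\<psi> \<otimes>\<^bsub>AutBall\<^esub> ?g \<otimes>\<^bsub>AutBall\<^esub> inv\<^bsub>AutBall\<^esub> ?\<psi>"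
    using g by (simp add: inner_automorphism_def)
  then have h: "?h \<in> carrier AutBall" using \<psi> g by simp
  have comm: "?h \<otimes>\<^bsub>AutBall\<^esub> ?\<psi> = ?\<psi> \<otimes>\<^bsub>AutBall\<^esub> ?g"
    unfolding h_eq using \<psi> g by (simp add: AutBall.m_assoc)
  obtain b V where b: "b \<in> ?B" and V: "unitary V" and hb: "?h = phi_aut b V"
    using AutBall_eq_phi_aut[OF h] by blast
  obtain d X where d: "d \<in> ?B" and X: "unitary X"
    and \<psi>g: "?\<psi> \<otimes>\<^bsub>AutBall\<^esub> ?g = phi_aut d X"
    using AutBall_eq_phi_aut[OF AutBall.m_closed[OF \<psi> g]] by blast
  obtain k where k: "k \<noteq> 0"
    "\<And>p. M_op c W (M_op 0 ((*\<^sub>C) u) p) = k *\<^sub>C M_op d X p"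
    using M_op_mult[OF c W zero R d X \<psi>g] by blast
  obtain k' where k': "\<And>p. M_op b V (M_op c W p) = k' *\<^sub>C M_op d X p"
    using M_op_mult[OF b V c W d X] \<psi>g comm hb by metis
  define w where "w = (t *\<^sub>C c, 1::complex)"
  define v where "v = M_op c W w"
  have "v \<noteq> 0"
    using M_op_eq_0D[OF c W, of w] by (auto simp: v_def w_def zero_prod_def)
  have "r\<^sup>2 * ((u * t - 1) * cnj (t - 1)) + (1 - u * t * r\<^sup>2) * cnj (1 - t * r\<^sup>2)
      = u * cnj s + s"
    using r by (simp add: t_def s_def power2_eq_square field_simps)
  also have "\<dots> = 0" using s(1) by (simp add: u_def)
  finally have "cinner (M_op c W (M_op 0 ((*\<^sub>C) u) w)) v = 0"
    unfolding v_def w_def cinner_M_op_on_axis[OF c W u r_def[symmetric]]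
    by (simp add: mult.commute)
  then have "cinner (M_op d X w) v = 0"
    using k by (simp add: cinner_scaleC_left)
  then have "cinner (M_op b V v) v = 0"
    unfolding v_def k' by (simp add: cinner_scaleC_left)
  then have "birkhoff_orth (M_op 0 id) (M_op b V)"
    unfolding M_op_id
    by (rule birkhoff_orth_id_if_cinner_eq_0[OF bounded_linear_M_op[OF V] \<open>v \<noteq> 0\<close>])
  then have "orth_Aut (phi_aut 0 id) ?h"
    unfolding hb orth_Aut_phi_aut_iff[OF zero unitary_id b V] .
  moreover have "inner_automorphism AutBall ?\<psi> (phi_aut 0 id) = phi_aut 0 id"
    unfolding phi_aut_one using \<psi> by (simp add: inner_automorphism_def)
  ultimately have "orth_Aut (phi_aut 0 id) ?g"
    using pres g unfolding preserves_orth_Aut_def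
    by (metis phi_aut_in_AutBall[OF zero unitary_id])
  then show False
    unfolding orth_Aut_phi_aut_iff[OF zero unitary_id zero R] M_op_id
    using scalar_rotation_not_birkhoff_orth_id[OF u u1] by blast
qed

theorem theorem1p4:
  fixes \<Phi> :: "('a::chilbert_space \<Rightarrow> 'a) \<Rightarrow> ('a \<Rightarrow> 'a)"
  assumes "\<exists>\<psi> \<in> carrier AutBall. \<Phi> = inner_automorphism AutBall \<psi>"
  shows "preserves_orth_Aut \<Phi> \<longleftrightarrow>
    (\<exists>W. unitary W \<and> \<Phi> = inner_automorphism AutBall (phi_aut 0 W))"
proof
  assume pres: "preserves_orth_Aut \<Phi>"
  obtain c W where "c \<in> unit_ball" "unitary W" "\<Phi> = inner_automorphism AutBall (phi_aut c W)"
    using assms AutBall_eq_phi_aut by metis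
  moreover from this have "c = 0"
    using pres not_preserves_orth_Aut_if_moves_0 by blast
  ultimately show "\<exists>W. unitary W \<and> \<Phi> = inner_automorphism AutBall (phi_aut 0 W)"
    by blast
qed (use inner_automorphism_rotation_preserves_orth_Aut in blast)

end
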